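(* Let $K$ be an algebraically closed field of characteristic $\ne2$, $G=\mathrm{PGL}_n(K)$, $n=2^st$ with $t$ odd and $s,t\ge1$. Let $1\le r\le s$, $n=2^rk$, and $D=D_r\times(H\otimes I_{2^r})$ where $H$ is trivial or a toral elementary abelian $2$-subgroup of $\mathrm{PGL}_k(K)$ with connected centralizer in $\mathrm{PGL}_k(K)$. Then $N_G(D)/C_G(D)$ contains a subgroup isomorphic to $\mathrm{GL}_r(2)$. Moreover, the conjugation action of $N_G(D)$ on $C_G(D)/C_G(D)^\circ$ has exactly two orbits: the identity, and all remaining elements.
   Context: Notation ($p=2$): for $0\le s'\le r-1$, $\sigma_{s'}$ is the permutation of $\{1,\dots,2^r\}$ with $\sigma_{s'}(i)=i+2^{s'}$ if $i\equiv 1,\dots,2^{s'}\pmod{2^{s'+1}}$ and $\sigma_{s'}(i)=i-2^{s'}$ otherwise; $A_{s'}$ is diagonal with $(A_{s'})_{ii}=(-1)^{\lfloor(i-1)/2^{s'}\rfloor}$; $B_{s'}$ is the permutation matrix of $\sigma_{s'}$ ($(B_{s'})_{ij}=1$ iff $\sigma_{s'}(i)=j$). $\bar A_{s'},\bar B_{s'}$ are the images in $\mathrm{PGL}_n(K)$ of $I_k\otimes A_{s'}$, $I_k\otimes B_{s'}$. $D_r=\langle\bar A_0,\dots,\bar A_{r-1}\rangle$. $H\otimes I_{2^r}$ is the image of $\{h\otimes I_{2^r}\}$. Toral: contained in a maximal torus. *)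

theory Defs
  imports "HOL-Analysis.Analysis" "Jordan_Normal_Form.Determinant" "HOL-Library.Z2" "HOL-Computational_Algebra.Polynomial"
begin

section \<open>Matrix groups GL_n(K); PGL_n(K) is handled through preimages in GL_n(K)\<close>

definition GLm :: "nat \<Rightarrow> 'a::field mat set" where
  "GLm n = {A \<in> carrier_mat n n. det A \<noteq> 0}"

text \<open>Nonzero scalar multiples of a set of matrices: the full preimage in GL_n of
  the image of the set in PGL_n.\<close>
definition scal :: "'a::field mat set \<Rightarrow> 'a mat set" where
  "scal X = {c \<cdot>\<^sub>m x | c x. c \<noteq> 0 \<and> x \<in> X}"

text \<open>Preimage in GL_n of the subgroup of PGL_n generated by the images of X.\<close>
inductive_set pgen :: "nat \<Rightarrow> 'a::field mat set \<Rightarrow> 'a mat set" for n X where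
  one: "1\<^sub>m n \<in> pgen n X"
| gen: "x \<in> X \<Longrightarrow> x \<in> pgen n X"
| mult: "a \<in> pgen n X \<Longrightarrow> b \<in> pgen n X \<Longrightarrow> a * b \<in> pgen n X"
| inv: "a \<in> pgen n X \<Longrightarrow> b \<in> carrier_mat n n \<Longrightarrow> a * b = 1\<^sub>m n \<Longrightarrow> b \<in> pgen n X"
| scal: "a \<in> pgen n X \<Longrightarrow> c \<noteq> 0 \<Longrightarrow> c \<cdot>\<^sub>m a \<in> pgen n X"

inductive_set polyfun :: "nat \<Rightarrow> ('a::field mat \<Rightarrow> 'a) set" for n where
  const: "(\<lambda>A. c) \<in> polyfun n"
| entry: "i < n \<Longrightarrow> j < n \<Longrightarrow> (\<lambda>A. A $$ (i, j)) \<in> polyfun n"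
| add: "f \<in> polyfun n \<Longrightarrow> g \<in> polyfun n \<Longrightarrow> (\<lambda>A. f A + g A) \<in> polyfun n"
| mult: "f \<in> polyfun n \<Longrightarrow> g \<in> polyfun n \<Longrightarrow> (\<lambda>A. f A * g A) \<in> polyfun n"

definition zariski :: "nat \<Rightarrow> 'a::field mat topology" where
  "zariski n = topology_generated_by
     {{A \<in> carrier_mat n n. f A \<noteq> 0} | f. f \<in> polyfun n}"

definition zariski_GL :: "nat \<Rightarrow> 'a::field mat topology" where
  "zariski_GL n = subtopology (zariski n) (GLm n)"

definition identity_component :: "nat \<Rightarrow> 'a::field mat set \<Rightarrow> 'a mat set" where
  "identity_component n S = connected_component_of_set (subtopology (zariski_GL n) S) (1\<^sub>m n)"

definition diagonalizable :: "nat \<Rightarrow> 'a::field mat \<Rightarrow> bool" where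
  "diagonalizable n A \<longleftrightarrow> (\<exists>P Dg. P \<in> GLm n \<and> Dg \<in> carrier_mat n n \<and> diagonal_mat Dg \<and> P * A = Dg * P)"

definition is_torus :: "nat \<Rightarrow> 'a::field mat set \<Rightarrow> bool" where
  "is_torus n T \<longleftrightarrow> T \<subseteq> GLm n \<and> 1\<^sub>m n \<in> T
     \<and> (\<forall>a\<in>T. \<forall>b\<in>T. a * b \<in> T)
     \<and> (\<forall>a\<in>T. \<forall>b\<in>carrier_mat n n. a * b = 1\<^sub>m n \<longrightarrow> b \<in> T)
     \<and> closedin (zariski_GL n) T \<and> connectedin (zariski_GL n) T
     \<and> (\<forall>a\<in>T. \<forall>b\<in>T. a * b = b * a)
     \<and> (\<forall>a\<in>T. diagonalizable n a)"

definition maximal_torus :: "nat \<Rightarrow> 'a::field mat set \<Rightarrow> bool" where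
  "maximal_torus n T \<longleftrightarrow> is_torus n T \<and> (\<forall>T'. is_torus n T' \<and> T \<subseteq> T' \<longrightarrow> T' = T)"

text \<open>Preimage in GL_n of the centralizer in PGL_n of the image of a set X.\<close>
definition pcentralizer :: "nat \<Rightarrow> 'a::field mat set \<Rightarrow> 'a mat set" where
  "pcentralizer n X = {g \<in> GLm n. \<forall>x\<in>X. \<exists>c. g * x = c \<cdot>\<^sub>m (x * g)}"

text \<open>Preimage in GL_n of the normalizer in PGL_n of the subgroup whose preimage is Y.\<close>
definition pnormalizer :: "nat \<Rightarrow> 'a::field mat set \<Rightarrow> 'a mat set" where
  "pnormalizer n Y = {g \<in> GLm n. (\<lambda>y. g * y) ` Y = (\<lambda>y. y * g) ` Y}"

definition kron :: "'a::field mat \<Rightarrow> 'a mat \<Rightarrow> 'a mat" where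
  "kron A B = mat (dim_row A * dim_row B) (dim_col A * dim_col B)
     (\<lambda>(i, j). A $$ (i div dim_row B, j div dim_col B) * B $$ (i mod dim_row B, j mod dim_col B))"

definition Amat :: "nat \<Rightarrow> nat \<Rightarrow> 'a::field mat" where
  "Amat r s' = mat (2^r) (2^r) (\<lambda>(i, j). if i = j then (-1) ^ (i div 2^s') else 0)"

text \<open>Preimage in GL_n (n = 2^r k) of D = D_r x (H (x) I_{2^r}), where H is the
  image in PGL_k of the set of matrices F.\<close>
definition Dpre :: "nat \<Rightarrow> nat \<Rightarrow> 'a::field mat set \<Rightarrow> 'a mat set" where
  "Dpre r k F = pgen (2^r * k)
     ({kron (1\<^sub>m k) (Amat r s') | s'. s' < r} \<union> {kron h (1\<^sub>m (2^r)) | h. h \<in> F})"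

definition GL2 :: "nat \<Rightarrow> bit mat set" where
  "GL2 r = {A \<in> carrier_mat r r. det A \<noteq> 0}"

end

theory Submission
  imports Defs
begin

text \<open>
  Split a matrix of size \<open>2^r k\<close> into \<open>k \<times> k\<close> blocks indexed by pairs of vectors of \<open>F_2^r\<close>.
  Commuting up to scalars with \<open>D_r\<close> forces the nonzero blocks to be those at positions
  \<open>(v, v + w)\<close> for one fixed shift \<open>w\<close>. Commuting with \<open>H \<otimes> I\<close> puts the blocks into the
  centralizer of \<open>H\<close>; since that centralizer is connected and commutators with involutions are
  \<open>\<plusminus>1\<close>, the blocks commute with \<open>H\<close> exactly. Hence the part with \<open>w = 0\<close> consists of the
  invertible elements of a linear space, so it is irreducible; it is also open and closed, hence
  it is the identity component, and the component group is \<open>F_2^r\<close>. The permutation matrices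
  of the linear automorphisms of \<open>F_2^r\<close> normalize \<open>D\<close> and act on the shifts in the natural way,
  where transvections already move any nonzero vector to any other.
\<close>

text \<open>With positions numbered from 0, the low \<open>r\<close> binary digits of a position
  give a vector of F_2^r and the remaining digits give its place in the factor of size
  \<open>k\<close>. In these coordinates D_r is the whole group of sign characters of F_2^r, acting
  diagonally. Its full character group is what linear automorphisms can permute, and since they move
  digits only, they leave the factor carrying H alone.

  The obstacle is the scalar in projective commutation. Two matrices that commute with some h up to
  different scalars have linear combinations that need not commute with h even projectively, so the
  argument by straight lines cannot start before these scalars are removed. That argument also needs
  an infinite field, which algebraic closure supplies.

  Passing to preimages in \<open>GLm\<close> leaves the component group unchanged, because the part
  of shift 0 contains all nonzero scalar matrices. In the last claim,
  \<open>g * x = y * c * g\<close> says that \<open>g\<close> conjugates \<open>x\<close> into the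
  coset of \<open>y\<close> modulo the identity component.\<close>

unbundle no vec_syntax

subsection \<open>Matrices\<close>

lemma one_smult_mat: "(1::'a::field) \<cdot>\<^sub>m a = a"
  by (intro eq_matI) auto

lemma zero_smult_mat: "a \<in> carrier_mat n m \<Longrightarrow> (0::'a::field) \<cdot>\<^sub>m a = 0\<^sub>m n m"
  by (intro eq_matI) auto

lemma smult_smult_times: "c \<cdot>\<^sub>m (d \<cdot>\<^sub>m a) = (c * d :: 'a::field) \<cdot>\<^sub>m a"
  by (intro eq_matI) auto

lemma GLm_carrier: "g \<in> GLm n \<Longrightarrow> g \<in> carrier_mat n n"
  by (simp add: GLm_def)

lemma GLm_mult: "a \<in> GLm n \<Longrightarrow> b \<in> GLm n \<Longrightarrow> a * b \<in> GLm n"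
  by (auto simp: GLm_def det_mult)

lemma GLmI:
  fixes a b :: "'a::field mat"
  assumes "a \<in> carrier_mat n n" "b \<in> carrier_mat n n" "a * b = 1\<^sub>m n"
  shows "a \<in> GLm n" "b \<in> GLm n" "b * a = 1\<^sub>m n"
proof -
  have "det a * det b = 1"
    using assms det_mult[of a n b] by simp
  then show "a \<in> GLm n" "b \<in> GLm n"
    using assms by (auto simp: GLm_def)
  show "b * a = 1\<^sub>m n"
    using mat_mult_left_right_inverse assms by blast
qed

lemma one_GLm: "1\<^sub>m n \<in> GLm n"
  by (simp add: GLm_def)

lemma GLm_smult: "a \<in> GLm n \<Longrightarrow> c \<noteq> 0 \<Longrightarrow> c \<cdot>\<^sub>m a \<in> GLm n"
  by (auto simp: GLm_def)

lemma nonzero_det_inverse: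
  fixes a :: "'a::field mat"
  assumes "a \<in> carrier_mat n n" "det a \<noteq> 0"
  obtains b where "b \<in> carrier_mat n n" "a * b = 1\<^sub>m n" "b * a = 1\<^sub>m n"
  using det_non_zero_imp_unit[OF assms, of undefined] unfolding Units_def ring_mat_def by auto

lemma GLm_inverse:
  assumes "a \<in> GLm n"
  obtains b where "b \<in> GLm n" "a * b = 1\<^sub>m n" "b * a = 1\<^sub>m n"
proof -
  have "a \<in> carrier_mat n n" "det a \<noteq> 0"
    using assms by (auto simp: GLm_def)
  then obtain b where "b \<in> carrier_mat n n" "a * b = 1\<^sub>m n" "b * a = 1\<^sub>m n"
    by (rule nonzero_det_inverse)
  then show thesis
    using that GLmI(2)[OF \<open>a \<in> carrier_mat n n\<close>] by blast
qed

lemma GLm_smult_eq_zero: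
  assumes "a \<in> GLm n" "n > 0" "c \<cdot>\<^sub>m a = 0\<^sub>m n n"
  shows "c = 0"
proof (rule ccontr)
  assume "c \<noteq> 0"
  then have "c \<cdot>\<^sub>m a \<in> GLm n"
    using assms GLm_smult by blast
  then show False
    using assms by (simp add: GLm_def)
qed

lemma GLm_smult_cancel:
  assumes "a \<in> GLm n" "n > 0" "c \<cdot>\<^sub>m a = d \<cdot>\<^sub>m a"
  shows "c = d"
proof -
  have a: "a \<in> carrier_mat n n"
    using assms by (simp add: GLm_def)
  have "(c - d) \<cdot>\<^sub>m a = c \<cdot>\<^sub>m a - d \<cdot>\<^sub>m a"
    using a by (intro eq_matI) (auto simp: algebra_simps)
  also have "\<dots> = 0\<^sub>m n n"
    using assms(3) a by auto
  finally show ?thesis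
    using GLm_smult_eq_zero[OF assms(1,2)] by fastforce
qed

section \<open>Commutation up to scalars; projective centralizers and normalizers\<close>

lemma GLm_projective_commute_nonzero:
  assumes "g \<in> GLm n" "x \<in> GLm n" "n > 0" "g * x = c \<cdot>\<^sub>m (x * g)"
  shows "c \<noteq> 0"
proof
  assume "c = 0"
  moreover have "x * g \<in> carrier_mat n n"
    using assms GLm_mult GLm_carrier by blast
  ultimately have "1 \<cdot>\<^sub>m (g * x) = 0\<^sub>m n n"
    using assms(4) by (simp add: one_smult_mat zero_smult_mat)
  then show False
    using GLm_smult_eq_zero[OF GLm_mult[OF assms(1,2)] assms(3)] by fastforce
qed

lemma pgen_GLm:
  assumes "X \<subseteq> GLm n" "x \<in> pgen n X"
  shows "x \<in> GLm n"
  using assms(2)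
proof induction
  case (inv a b)
  then show ?case using GLmI(2) GLm_carrier by blast
qed (use assms(1) in \<open>auto intro: one_GLm GLm_mult GLm_smult\<close>)

lemma smult_mult_mat:
  fixes a b :: "'a::field mat"
  assumes "a \<in> carrier_mat n n" "b \<in> carrier_mat n n"
  shows "(c \<cdot>\<^sub>m a) * b = c \<cdot>\<^sub>m (a * b)" "a * (c \<cdot>\<^sub>m b) = c \<cdot>\<^sub>m (a * b)"
  using assms by auto

text \<open>Multiply \<open>x * a = c \<cdot>\<^sub>m (a * x)\<close> by \<open>b\<close> on both
  sides. Having \<open>x\<close> on the left in the assumption lets the same \<open>c\<close> appear
  in the conclusion, with no division.\<close>

lemma projective_commute_inverse:
  fixes a b x :: "'a::field mat"
  assumes "a \<in> carrier_mat n n" "b \<in> carrier_mat n n" "x \<in> carrier_mat n n"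
    and "a * b = 1\<^sub>m n" "b * a = 1\<^sub>m n" "x * a = c \<cdot>\<^sub>m (a * x)"
  shows "b * x = c \<cdot>\<^sub>m (x * b)"
proof -
  have "b * x = b * (x * a) * b"
    using assms(1-5) by (simp add: assoc_mult_mat[of _ n n _ n _ n])
  also have "\<dots> = c \<cdot>\<^sub>m (b * (a * x)) * b"
    using assms(1-3) by (simp add: assms(6) smult_mult_mat[of _ n])
  also have "\<dots> = c \<cdot>\<^sub>m (x * b)"
    using assms(1-5) by (simp add: assoc_mult_mat[of _ n n _ n _ n, symmetric] smult_mult_mat[of _ n])
  finally show ?thesis .
qed

lemma smult_inverse_eq:
  fixes a b :: "'a::field mat"
  assumes "c \<noteq> 0" "a = c \<cdot>\<^sub>m b"
  shows "b = inverse c \<cdot>\<^sub>m a"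
  using assms by (simp add: smult_smult_times one_smult_mat)

text \<open>The commutator scalar is multiplicative in the second argument. The case of inverses
  turns the scalar around, which requires it to be nonzero, and this is where positive size
  enters.\<close>

lemma pcentralizer_pgen:
  fixes X :: "'a::field mat set"
  assumes X: "X \<subseteq> GLm n" and n: "n > 0"
  shows "pcentralizer n (pgen n X) = pcentralizer n X"
proof
  show "pcentralizer n (pgen n X) \<subseteq> pcentralizer n X"
    by (auto simp: pcentralizer_def intro: pgen.gen)
next
  show "pcentralizer n X \<subseteq> pcentralizer n (pgen n X)"
  proof
    fix g assume g: "g \<in> pcentralizer n X"
    then have G: "g \<in> GLm n" by (simp add: pcentralizer_def)
    then have gc: "g \<in> carrier_mat n n" by (rule GLm_carrier)
    have "\<exists>c. g * x = c \<cdot>\<^sub>m (x * g)" if "x \<in> pgen n X" for x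
      using that
    proof induction
      case one
      show ?case using gc by (intro exI[of _ 1]) auto
    next
      case (gen x)
      then show ?case using g by (auto simp: pcentralizer_def)
    next
      case (mult a b)
      then have ab: "a \<in> carrier_mat n n" "b \<in> carrier_mat n n"
        using pgen_GLm[OF X] GLm_carrier by blast+
      from mult obtain c d where c: "g * a = c \<cdot>\<^sub>m (a * g)" and d: "g * b = d \<cdot>\<^sub>m (b * g)"
        by auto
      have "g * (a * b) = (g * a) * b"
        using ab gc by simp
      also have "\<dots> = c \<cdot>\<^sub>m (a * (g * b))"
        using ab gc by (simp add: c smult_mult_mat[of _ n])
      also have "\<dots> = (c * d) \<cdot>\<^sub>m (a * b * g)"
        using ab gc by (simp add: d smult_mult_mat[of _ n] smult_smult_times)
      finally show ?case by blast
    next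
      case (inv a b)
      then have a: "a \<in> GLm n"
        using pgen_GLm[OF X] by blast
      from inv obtain c where c: "g * a = c \<cdot>\<^sub>m (a * g)" by auto
      have "c \<noteq> 0"
        using GLm_projective_commute_nonzero[OF G a n c] .
      moreover have "b * g = c \<cdot>\<^sub>m (g * b)"
        using projective_commute_inverse[of a n b g c] a inv gc c GLmI(3) GLm_carrier by blast
      ultimately show ?case
        using smult_inverse_eq by blast
    next
      case (scal a c)
      then obtain d where d: "g * a = d \<cdot>\<^sub>m (a * g)" by auto
      have a: "a \<in> carrier_mat n n"
        using scal pgen_GLm[OF X] GLm_carrier by blast
      show ?case
        using a gc by (intro exI[of _ d]) (simp add: smult_mult_mat[of _ n] d smult_smult_times mult.commute)
    qed
    then show "g \<in> pcentralizer n (pgen n X)"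
      using G by (auto simp: pcentralizer_def)
  qed
qed

lemma pcentralizer_mult:
  assumes X: "X \<subseteq> carrier_mat n n" and "a \<in> pcentralizer n X" "b \<in> pcentralizer n X"
  shows "a * b \<in> pcentralizer n X"
proof -
  have ab: "a \<in> GLm n" "b \<in> GLm n"
    using assms by (auto simp: pcentralizer_def)
  then have c: "a \<in> carrier_mat n n" "b \<in> carrier_mat n n"
    using GLm_carrier by blast+
  have "\<exists>c. (a * b) * x = c \<cdot>\<^sub>m (x * (a * b))" if x: "x \<in> X" for x
  proof -
    have xc: "x \<in> carrier_mat n n" using X x by blast
    obtain p q where p: "a * x = p \<cdot>\<^sub>m (x * a)" and q: "b * x = q \<cdot>\<^sub>m (x * b)"
      using assms x by (fastforce simp: pcentralizer_def)
    have "(a * b) * x = a * (b * x)"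
      using c xc by simp
    also have "\<dots> = q \<cdot>\<^sub>m (a * x * b)"
      using c xc by (simp add: q smult_mult_mat[of _ n])
    also have "\<dots> = (q * p) \<cdot>\<^sub>m (x * (a * b))"
      using c xc by (simp add: p smult_mult_mat[of _ n] smult_smult_times)
    finally show ?thesis by blast
  qed
  then show ?thesis
    using ab GLm_mult by (auto simp: pcentralizer_def)
qed

lemma pcentralizer_inverse:
  assumes X: "X \<subseteq> GLm n" and n: "n > 0" and "a \<in> pcentralizer n X" "b \<in> GLm n"
    and ab: "a * b = 1\<^sub>m n" "b * a = 1\<^sub>m n"
  shows "b \<in> pcentralizer n X"
proof -
  have a: "a \<in> GLm n"
    using assms by (auto simp: pcentralizer_def)
  have "\<exists>c. b * x = c \<cdot>\<^sub>m (x * b)" if x: "x \<in> X" for x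
  proof -
    obtain p where p: "a * x = p \<cdot>\<^sub>m (x * a)"
      using assms x by (auto simp: pcentralizer_def)
    have xG: "x \<in> GLm n" using X x by blast
    have "p \<noteq> 0"
      using GLm_projective_commute_nonzero[OF a xG n p] .
    then have "x * a = inverse p \<cdot>\<^sub>m (a * x)"
      using p smult_inverse_eq by blast
    then show ?thesis
      using projective_commute_inverse[of a n b x] a assms xG GLm_carrier by blast
  qed
  then show ?thesis
    using assms by (auto simp: pcentralizer_def)
qed

lemma conj_pgen:
  fixes X :: "'a::field mat set"
  assumes X: "X \<subseteq> GLm n" and g: "g \<in> GLm n" "g' \<in> GLm n" "g * g' = 1\<^sub>m n" "g' * g = 1\<^sub>m n"
    and gen: "\<And>x. x \<in> X \<Longrightarrow> g * x * g' \<in> pgen n X" and y: "y \<in> pgen n X"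
  shows "g * y * g' \<in> pgen n X"
proof -
  have gc: "g \<in> carrier_mat n n" "g' \<in> carrier_mat n n"
    using g GLm_carrier by blast+
  have hom: "g * (a * b) * g' = (g * a * g') * (g * b * g')"
    if ab: "a \<in> carrier_mat n n" "b \<in> carrier_mat n n" for a b
  proof -
    have "(g * a * g') * (g * b * g') = g * a * (g' * g) * b * g'"
      using gc ab by (simp only: assoc_mult_mat[of _ n n _ n _ n] mult_carrier_mat[of _ n n _ n])
    also have "\<dots> = g * (a * b) * g'"
      using gc ab by (simp add: g)
    finally show ?thesis by simp
  qed
  show ?thesis
    using y
  proof induction
    case one
    show ?case using gc g by (auto intro: pgen.one)
  next
    case (gen x)
    then show ?case by (rule assms(6))
  next
    case (mult a b)
    then have ab: "a \<in> carrier_mat n n" "b \<in> carrier_mat n n"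
      using pgen_GLm[OF X] GLm_carrier by blast+
    show ?case
      using mult by (simp add: hom[OF ab] pgen.mult)
  next
    case (inv a b)
    then have a: "a \<in> carrier_mat n n"
      using pgen_GLm[OF X] GLm_carrier by blast
    have "(g * a * g') * (g * b * g') = 1\<^sub>m n"
      using hom[OF a inv(2)] inv(3) gc g by simp
    moreover have "g * b * g' \<in> carrier_mat n n"
      using gc inv by simp
    ultimately show ?case
      using inv pgen.inv by blast
  next
    case (scal a c)
    then have a: "a \<in> carrier_mat n n"
      using pgen_GLm[OF X] GLm_carrier by blast
    have "g * (c \<cdot>\<^sub>m a) * g' = c \<cdot>\<^sub>m (g * a * g')"
      using a gc by (simp add: smult_mult_mat[of _ n])
    then show ?case
      using scal by (simp add: pgen.scal)
  qed
qed

text \<open>\<open>pnormalizer\<close> asks for equality of the two cosets, so one inclusion comes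
  from conjugation by \<open>g\<close> and the other from conjugation by \<open>g'\<close>; each
  needs checking on generators only.\<close>

lemma pnormalizer_pgenI:
  fixes X :: "'a::field mat set"
  assumes X: "X \<subseteq> GLm n" and g: "g \<in> GLm n" "g' \<in> GLm n" "g * g' = 1\<^sub>m n" "g' * g = 1\<^sub>m n"
    and gen: "\<And>x. x \<in> X \<Longrightarrow> g * x * g' \<in> pgen n X" "\<And>x. x \<in> X \<Longrightarrow> g' * x * g \<in> pgen n X"
  shows "g \<in> pnormalizer n (pgen n X)"
proof -
  have gc: "g \<in> carrier_mat n n" "g' \<in> carrier_mat n n"
    using g GLm_carrier by blast+
  have "\<exists>z\<in>pgen n X. g * y = z * g" "\<exists>z\<in>pgen n X. y * g = g * z" if y: "y \<in> pgen n X" for y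
  proof -
    have yc: "y \<in> carrier_mat n n"
      using y pgen_GLm[OF X] GLm_carrier by blast
    have "g * y * g' * g = g * y"
      using gc yc by (simp add: assoc_mult_mat[of _ n n _ n _ n] g)
    then show "\<exists>z\<in>pgen n X. g * y = z * g"
      using conj_pgen[OF X g gen(1) y] by metis
    have "g * (g' * y * g) = (g * g') * y * g"
      using gc yc by (simp only: assoc_mult_mat[of _ n n _ n _ n] mult_carrier_mat[of _ n n _ n])
    also have "\<dots> = y * g"
      using g gc yc by simp
    finally show "\<exists>z\<in>pgen n X. y * g = g * z"
      using conj_pgen[OF X g(2,1,4,3) gen(2) y] by metis
  qed
  then show ?thesis
    using g by (auto simp: pnormalizer_def image_iff)
qed

subsection \<open>The Zariski topology\<close>

lemma openin_zariski_basic: "f \<in> polyfun n \<Longrightarrow> openin (zariski n) {A \<in> carrier_mat n n. f A \<noteq> 0}"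
  unfolding zariski_def by (rule topology_generated_by_Basis) blast

lemma topspace_zariski: "topspace (zariski n) = (carrier_mat n n :: 'a::field mat set)"
proof
  show "topspace (zariski n) \<subseteq> (carrier_mat n n :: 'a mat set)"
    by (auto simp: zariski_def)
  have "openin (zariski n) {A :: 'a mat. A \<in> carrier_mat n n \<and> (\<lambda>_. 1 :: 'a) A \<noteq> 0}"
    by (intro openin_zariski_basic polyfun.const)
  from openin_subset[OF this] show "carrier_mat n n \<subseteq> topspace (zariski n :: 'a mat topology)"
    by simp
qed

lemma topspace_zariski_GL: "topspace (zariski_GL n) = GLm n"
  by (auto simp: zariski_GL_def topspace_zariski GLm_def)

text \<open>The generating sets already form a basis: two nonvanishing loci meet in the nonvanishing
  locus of the product.\<close>

lemma zariski_basic_neighbourhood: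
  assumes "openin (zariski n) U" "x \<in> U"
  obtains f where "f \<in> polyfun n" "f x \<noteq> 0" "{A \<in> carrier_mat n n. f A \<noteq> 0} \<subseteq> U"
proof -
  have "generate_topology_on {{A \<in> carrier_mat n n. f A \<noteq> 0} | f. f \<in> polyfun n} U"
    using assms(1) by (simp add: zariski_def openin_topology_generated_by)
  then have "\<exists>f\<in>polyfun n. f x \<noteq> 0 \<and> {A \<in> carrier_mat n n. f A \<noteq> 0} \<subseteq> U"
    using assms(2)
  proof induction
    case (Int a b)
    then obtain f g where "f \<in> polyfun n" "f x \<noteq> 0" "{A \<in> carrier_mat n n. f A \<noteq> 0} \<subseteq> a"
      "g \<in> polyfun n" "g x \<noteq> 0" "{A \<in> carrier_mat n n. g A \<noteq> 0} \<subseteq> b"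
      by auto
    then show ?case
      by (intro bexI[of _ "\<lambda>A. f A * g A"]) (auto intro: polyfun.mult)
  next
    case (UN K)
    then obtain k where k: "k \<in> K" "x \<in> k" by blast
    show ?case
      using UN.IH[OF k] k(1) by blast
  qed auto
  then show ?thesis using that by blast
qed

lemma polyfun_line:
  assumes "f \<in> polyfun n" "x \<in> carrier_mat n n" "d \<in> carrier_mat n n"
  shows "\<exists>p. \<forall>t. poly p t = f (x + t \<cdot>\<^sub>m d)"
  using assms(1)
proof induction
  case (const c)
  show ?case by (rule exI[of _ "[:c:]"]) simp
next
  case (entry i j)
  then show ?case
    using assms(2,3) by (intro exI[of _ "[:x $$ (i,j), d $$ (i,j):]"]) auto
next
  case (add f g)
  then show ?case by (metis poly_add)
next
  case (mult f g)
  then show ?case by (metis poly_mult)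
qed

text \<open>No expansion of the determinant is required: take it over the polynomial ring, with
  linear entries, and use that evaluation at \<open>t\<close> is a ring homomorphism.\<close>

lemma det_line:
  fixes x d :: "'a::field mat"
  assumes "x \<in> carrier_mat n n" "d \<in> carrier_mat n n"
  shows "\<exists>p. \<forall>t. poly p t = det (x + t \<cdot>\<^sub>m d)"
proof -
  define P where "P = mat n n (\<lambda>(i,j). [:x $$ (i,j), d $$ (i,j):])"
  have "poly (det P) t = det (x + t \<cdot>\<^sub>m d)" for t
  proof -
    interpret comm_ring_hom "\<lambda>p :: 'a poly. poly p t"
      by unfold_locales auto
    have "map_mat (\<lambda>p. poly p t) P = x + t \<cdot>\<^sub>m d"
      using assms by (intro eq_matI) (auto simp: P_def)
    then show ?thesis
      using hom_det[of P] by simp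
  qed
  then show ?thesis by blast
qed

text \<open>Euclid's argument: over a finite field, 1 plus the product of all
  \<open>[:-a, 1:]\<close> has positive degree but takes only the value 1.\<close>

lemma infinite_algebraically_closed:
  assumes "\<forall>p :: 'a::field poly. degree p \<ge> 1 \<longrightarrow> (\<exists>x. poly p x = 0)"
  shows "infinite (UNIV :: 'a set)"
proof
  assume fin: "finite (UNIV :: 'a set)"
  define q :: "'a poly" where "q = (\<Prod>a\<in>UNIV. [:-a, 1:])"
  have "degree q = card (UNIV :: 'a set)"
    unfolding q_def by (subst degree_prod_eq_sum_degree) auto
  moreover have "card {0, 1 :: 'a} \<le> card (UNIV :: 'a set)"
    by (rule card_mono[OF fin]) simp
  ultimately have dq: "degree q \<ge> 1" by simp
  then have "degree (q + 1) = degree q"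
    by (intro degree_add_eq_left) auto
  then obtain x where "poly (q + 1) x = 0"
    using assms dq by metis
  moreover have "poly q x = 0"
    unfolding q_def poly_prod using fin by (subst prod_zero_iff) auto
  ultimately show False by simp
qed

text \<open>On the line through two points of \<open>V\<close> all but finitely many points are invertible, so
  \<open>V\<close> is even irreducible.\<close>
lemma connectedin_zariski_affine:
  fixes V :: "'a::field mat set"
  assumes inf: "infinite (UNIV :: 'a set)" and V: "V \<subseteq> GLm n"
    and line: "\<And>x y t. x \<in> V \<Longrightarrow> y \<in> V \<Longrightarrow> x + t \<cdot>\<^sub>m (y - x) \<in> GLm n \<Longrightarrow> x + t \<cdot>\<^sub>m (y - x) \<in> V"
  shows "connectedin (zariski_GL n) V"
proof -
  have False if E: "openin (zariski_GL n) E1" "openin (zariski_GL n) E2"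
    "E1 \<inter> E2 \<inter> V = {}" "x \<in> E1" "x \<in> V" "y \<in> E2" "y \<in> V" for E1 E2 x y
  proof -
    obtain U1 U2 where U: "openin (zariski n) U1" "E1 = U1 \<inter> GLm n"
      "openin (zariski n) U2" "E2 = U2 \<inter> GLm n"
      using E(1,2) unfolding zariski_GL_def openin_subtopology by blast
    have "x \<in> U1" "y \<in> U2"
      using E(4,6) U(2,4) by auto
    obtain f where f: "f \<in> polyfun n" "f x \<noteq> 0" "{A \<in> carrier_mat n n. f A \<noteq> 0} \<subseteq> U1"
      using U(1) \<open>x \<in> U1\<close> by (rule zariski_basic_neighbourhood)
    obtain g where g: "g \<in> polyfun n" "g y \<noteq> 0" "{A \<in> carrier_mat n n. g A \<noteq> 0} \<subseteq> U2"
      using U(3) \<open>y \<in> U2\<close> by (rule zariski_basic_neighbourhood)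
    have c: "x \<in> carrier_mat n n" "y \<in> carrier_mat n n"
      using E V GLm_carrier by blast+
    then have d: "y - x \<in> carrier_mat n n" by auto
    obtain p where p: "\<And>t. poly p t = f (x + t \<cdot>\<^sub>m (y - x))"
      using polyfun_line[OF f(1) c(1) d] by auto
    obtain q where q: "\<And>t. poly q t = g (x + t \<cdot>\<^sub>m (y - x))"
      using polyfun_line[OF g(1) c(1) d] by auto
    obtain u where u: "\<And>t. poly u t = det (x + t \<cdot>\<^sub>m (y - x))"
      using det_line[OF c(1) d] by auto
    have x0: "x + 0 \<cdot>\<^sub>m (y - x) = x" and y1: "x + 1 \<cdot>\<^sub>m (y - x) = y"
      using c by (auto intro!: eq_matI)
    \<comment> \<open>The parameters 0 and 1 correspond to \<open>x\<close> and \<open>y\<close>.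
      Each of the three polynomials is nonzero at one of them, so their product is a nonzero
      polynomial and an infinite field has a point outside its roots.\<close>
    have "poly p 0 \<noteq> 0" "poly q 1 \<noteq> 0"
      using f g by (simp_all add: p q x0 y1)
    moreover have "poly u 0 \<noteq> 0"
      using E V by (auto simp: u x0 GLm_def)
    ultimately have "p * q * u \<noteq> 0"
      by (metis mult_eq_0_iff poly_0)
    then have "finite {t. poly (p * q * u) t = 0}"
      by (rule poly_roots_finite)
    then obtain t where "poly (p * q * u) t \<noteq> 0"
      using ex_new_if_finite[OF inf, of "{t. poly (p * q * u) t = 0}"] by blast
    then have nz: "f (x + t \<cdot>\<^sub>m (y - x)) \<noteq> 0" "g (x + t \<cdot>\<^sub>m (y - x)) \<noteq> 0"
      "det (x + t \<cdot>\<^sub>m (y - x)) \<noteq> 0"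
      by (auto simp: p q u)
    have tc: "x + t \<cdot>\<^sub>m (y - x) \<in> carrier_mat n n"
      using c(1) d by simp
    then have "x + t \<cdot>\<^sub>m (y - x) \<in> GLm n"
      using nz(3) by (simp add: GLm_def)
    moreover have "x + t \<cdot>\<^sub>m (y - x) \<in> U1" "x + t \<cdot>\<^sub>m (y - x) \<in> U2"
      using nz(1,2) tc f(3) g(3) by auto
    ultimately have "x + t \<cdot>\<^sub>m (y - x) \<in> E1 \<inter> E2 \<inter> V"
      using line[OF E(5,7)] U(2,4) by blast
    then show False
      using E(3) by blast
  qed
  then show ?thesis
    unfolding connectedin topspace_zariski_GL using V by blast
qed

lemma polyfun_sum:
  assumes "\<And>i. i \<in> I \<Longrightarrow> f i \<in> polyfun n"
  shows "(\<lambda>A. \<Sum>i\<in>I. f i A) \<in> polyfun n"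
  using assms
proof (induction I rule: infinite_finite_induct)
  case (insert i I)
  then show ?case using polyfun.add[of "f i" n "\<lambda>A. \<Sum>i\<in>I. f i A"] by simp
qed (auto intro: polyfun.const)

text \<open>The form in which matrix equations are shown to be closed: the failure of such an
  equation is a finite union of basic open sets, one per entry.\<close>

lemma openin_zariski_nonzero:
  assumes "\<And>i j. i < n \<Longrightarrow> j < n \<Longrightarrow> f i j \<in> polyfun n"
  shows "openin (zariski_GL n) {g \<in> GLm n. \<exists>i<n. \<exists>j<n. f i j g \<noteq> 0}"
proof -
  have "openin (zariski n) (\<Union>i\<in>{..<n}. \<Union>j\<in>{..<n}. {g \<in> carrier_mat n n. f i j g \<noteq> 0})"
    using assms openin_zariski_basic by (intro openin_Union) blast
  moreover have "{g \<in> GLm n. \<exists>i<n. \<exists>j<n. f i j g \<noteq> 0} =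
      (\<Union>i\<in>{..<n}. \<Union>j\<in>{..<n}. {g \<in> carrier_mat n n. f i j g \<noteq> 0}) \<inter> GLm n"
    by (auto simp: GLm_def)
  ultimately show ?thesis
    by (auto simp: zariski_GL_def openin_subtopology)
qed

text \<open>The commutator of \<open>h\<close> with an element of its projective centralizer is \<open>1\<close> or \<open>-1\<close>, and
  both values are closed conditions.\<close>
lemma connected_pcentralizer_commute:
  fixes X :: "'a::field mat set"
  assumes char: "(2::'a) \<noteq> 0" and n: "n > 0" and X: "X \<subseteq> GLm n"
    and conn: "connectedin (zariski_GL n) (pcentralizer n X)"
    and h: "h \<in> X" and hh: "h * h \<in> scal {1\<^sub>m n}" and g: "g \<in> pcentralizer n X"
  shows "g * h = h * g"
proof (rule ccontr)
  assume neq: "g * h \<noteq> h * g"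
  have hG: "h \<in> GLm n" and hc: "h \<in> carrier_mat n n"
    using h X GLm_carrier by blast+
  obtain d where d: "d \<noteq> 0" "h * h = d \<cdot>\<^sub>m 1\<^sub>m n"
    using hh by (auto simp: scal_def)
  have pm: "x * h = h * x \<or> x * h = (-1) \<cdot>\<^sub>m (h * x)" if x: "x \<in> pcentralizer n X" for x
  proof -
    have xG: "x \<in> GLm n" and xc: "x \<in> carrier_mat n n"
      using x GLm_carrier by (auto simp: pcentralizer_def)
    obtain c where c: "x * h = c \<cdot>\<^sub>m (h * x)"
      using x h by (auto simp: pcentralizer_def)
    \<comment> \<open>Since \<open>h\<close> squares to a scalar, moving \<open>x\<close> past
      \<open>h\<close> twice compares 1 with \<open>c * c\<close>.\<close>
    have "d \<cdot>\<^sub>m x = x * (h * h)"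
      using xc by (simp add: d(2) smult_mult_mat[of _ n])
    also have "\<dots> = x * h * h"
      using xc hc by simp
    also have "\<dots> = c \<cdot>\<^sub>m (h * (x * h))"
      using xc hc by (simp add: c smult_mult_mat[of _ n])
    also have "\<dots> = (c * c) \<cdot>\<^sub>m (h * h * x)"
      using xc hc by (simp add: c smult_mult_mat[of _ n] smult_smult_times)
    also have "\<dots> = (c * c * d) \<cdot>\<^sub>m x"
      using xc hc by (simp add: d(2) smult_mult_mat[of _ n] smult_smult_times)
    finally have "d = c * c * d"
      by (rule GLm_smult_cancel[OF xG n])
    then have "c * c = 1"
      using d(1) by simp
    then have "c = 1 \<or> c = -1"
      by (simp add: square_eq_1_iff)
    then show ?thesis
      using c xc hc by auto
  qed
  \<comment> \<open>\<open>E \<epsilon>\<close> is the locus where \<open>x * h\<close> plus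
    \<epsilon> times \<open>h * x\<close> is nonzero. Within the centralizer, \<open>E 1\<close>
    therefore consists of the commuting elements and \<open>E (-1)\<close> of the anticommuting
    ones, so the two open sets would disconnect it if both occurred.\<close>
  define E where "E \<epsilon> = {x \<in> GLm n. \<exists>i<n. \<exists>j<n.
    (\<Sum>l<n. x $$ (i,l) * h $$ (l,j)) + \<epsilon> * (\<Sum>l<n. h $$ (i,l) * x $$ (l,j)) \<noteq> 0}" for \<epsilon>
  have openE: "openin (zariski_GL n) (E \<epsilon>)" for \<epsilon>
    unfolding E_def
    by (intro openin_zariski_nonzero polyfun.add polyfun_sum polyfun.mult polyfun.const polyfun.entry) auto
  have E_iff: "x \<in> E \<epsilon> \<longleftrightarrow> x \<in> GLm n \<and> x * h \<noteq> (-\<epsilon>) \<cdot>\<^sub>m (h * x)" for x \<epsilon>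
  proof (cases "x \<in> GLm n")
    case True
    then have xc: "x \<in> carrier_mat n n" by (rule GLm_carrier)
    have "x * h = (-\<epsilon>) \<cdot>\<^sub>m (h * x) \<longleftrightarrow>
        (\<forall>i<n. \<forall>j<n. (x * h) $$ (i,j) + \<epsilon> * (h * x) $$ (i,j) = 0)"
      using xc hc by (auto simp: mat_eq_iff eq_neg_iff_add_eq_0)
    also have "\<dots> \<longleftrightarrow> x \<notin> E \<epsilon>"
      using True xc hc by (simp add: E_def scalar_prod_def lessThan_atLeast0)
    finally show ?thesis
      using True by blast
  qed (simp add: E_def)
  have "g \<in> GLm n" using g by (simp add: pcentralizer_def)
  have not_both: "x * h \<noteq> h * x \<or> x * h \<noteq> (-1) \<cdot>\<^sub>m (h * x)" if "x \<in> GLm n" for x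
  proof (rule ccontr)
    assume "\<not> ?thesis"
    then have "1 \<cdot>\<^sub>m (h * x) = (-1) \<cdot>\<^sub>m (h * x)"
      by (metis one_smult_mat)
    then have "(1::'a) = -1"
      using GLm_smult_cancel GLm_mult hG n that by blast
    then have "(2::'a) = 0" by (metis add.right_inverse one_add_one)
    then show False using char by simp
  qed
  have oneC: "1\<^sub>m n \<in> pcentralizer n X"
  proof -
    have "1\<^sub>m n * x = 1 \<cdot>\<^sub>m (x * 1\<^sub>m n)" if "x \<in> X" for x
      using X that GLm_carrier[of x n] by (auto simp: one_smult_mat)
    then show ?thesis
      using one_GLm by (auto simp: pcentralizer_def)
  qed
  have C: "pcentralizer n X \<subseteq> GLm n" by (auto simp: pcentralizer_def)
  have E1: "x \<in> E 1 \<longleftrightarrow> x \<in> GLm n \<and> x * h \<noteq> (-1) \<cdot>\<^sub>m (h * x)" for x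
    by (simp add: E_iff)
  have E2: "x \<in> E (-1) \<longleftrightarrow> x \<in> GLm n \<and> x * h \<noteq> h * x" for x
    by (simp add: E_iff one_smult_mat)
  have "pcentralizer n X \<subseteq> E 1 \<union> E (-1)"
    using not_both C E1 E2 by blast
  moreover have "E 1 \<inter> E (-1) \<inter> pcentralizer n X = {}"
    using pm E1 E2 by blast
  moreover have "1\<^sub>m n \<in> E 1"
    using not_both[OF one_GLm] hc one_GLm by (auto simp: E1)
  moreover have "g \<in> E (-1)"
    using neq \<open>g \<in> GLm n\<close> by (simp add: E2)
  ultimately show False
    using connectedinD[OF conn openE openE, of 1 "-1"] oneC g by blast
qed

subsection \<open>Binary coordinates\<close>

declare add_bit_eq_xor [simp del] mult_bit_eq_and [simp del]

text \<open>Coordinates on the tensor factor of size \<open>2 ^ r\<close>, least significant digit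
  first, so that coordinate \<open>s\<close> carries the sign of \<open>Amat r s\<close>. The factor
  of size \<open>k\<close> is recorded by \<open>i div 2 ^ r\<close>.\<close>

definition bits :: "nat \<Rightarrow> nat \<Rightarrow> bit vec" where
  "bits r i = vec r (\<lambda>s. if odd (i div 2 ^ s) then 1 else 0)"

text \<open>Recovers a position from its place \<open>a\<close> in the factor of size
  \<open>k\<close> and its digit vector; \<open>horner_sum\<close> reads the digits as a binary
  number.\<close>

definition index :: "nat \<Rightarrow> nat \<Rightarrow> bit vec \<Rightarrow> nat" where
  "index r a v = 2 ^ r * a + horner_sum of_bool 2 (map (\<lambda>s. v $ s = 1) [0..<r])"

lemma bits_carrier: "bits r i \<in> carrier_vec r"
  by (simp add: bits_def)

lemma dim_bits [simp]: "dim_vec (bits r i) = r"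
  by (simp add: bits_def)

lemma bits_nth: "s < r \<Longrightarrow> bits r i $ s = (if odd (i div 2 ^ s) then 1 else 0)"
  by (simp add: bits_def)

lemma horner_less: "horner_sum of_bool 2 (map (\<lambda>s. v $ s = (1::bit)) [0..<r]) < (2 ^ r :: nat)"
  using horner_sum_of_bool_2_less[of "map (\<lambda>s. v $ s = (1::bit)) [0..<r]", where ?'a = nat] by simp

lemma index_div [simp]: "index r a v div 2 ^ r = a"
  unfolding index_def using horner_less[of v r] by simp

lemma index_mod: "index r a v mod 2 ^ r = horner_sum of_bool 2 (map (\<lambda>s. v $ s = 1) [0..<r])"
  unfolding index_def using horner_less[of v r] by simp

lemma index_less: "a < k \<Longrightarrow> index r a v < 2 ^ r * k"
  by (metis index_div less_mult_imp_div_less div_less_iff_less_mult mult.commute zero_less_numeral zero_less_power)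

lemma bits_index [simp]:
  assumes "v \<in> carrier_vec r"
  shows "bits r (index r a v) = v"
proof (intro eq_vecI)
  fix s assume "s < dim_vec v"
  then have s: "s < r" using assms by simp
  have "odd (index r a v div 2 ^ s) = bit (take_bit r (index r a v)) s"
    using s by (simp add: bit_take_bit_iff flip: bit_iff_odd)
  also have "\<dots> \<longleftrightarrow> v $ s = 1"
    using s by (simp add: take_bit_eq_mod index_mod bit_horner_sum_bit_iff)
  finally show "bits r (index r a v) $ s = v $ s"
    using s by (cases "v $ s") (auto simp: bits_nth)
qed (use assms in simp)

lemma index_bits [simp]: "index r (i div 2 ^ r) (bits r i) = i"
proof -
  have "map (\<lambda>s. bits r i $ s = 1) [0..<r] = map (bit i) [0..<r]"
    by (auto simp: bits_nth bit_iff_odd)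
  then have "horner_sum of_bool 2 (map (\<lambda>s. bits r i $ s = 1) [0..<r]) = take_bit r i"
    by (simp only: horner_sum_bit_eq_take_bit)
  then show ?thesis
    by (simp add: index_def take_bit_eq_mod)
qed

lemma bits_mod: "bits r (i mod 2 ^ r) = bits r i"
proof (intro eq_vecI)
  fix s assume "s < dim_vec (bits r i)"
  then have s: "s < r" by simp
  have "bit (take_bit r i) s = bit i s"
    using s by (simp add: bit_take_bit_iff)
  then show "bits r (i mod 2 ^ r) $ s = bits r i $ s"
    using s by (simp add: bits_nth bit_iff_odd take_bit_eq_mod)
qed simp

lemma bits_eq_iff: "bits r i = bits r j \<longleftrightarrow> i mod 2 ^ r = j mod 2 ^ r"
proof
  assume *: "bits r i = bits r j"
  have "l mod 2 ^ r = index r 0 (bits r l)" for l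
    using index_bits[of r "l mod 2 ^ r"] by (simp add: bits_mod)
  then show "i mod 2 ^ r = j mod 2 ^ r"
    using * by simp
next
  assume "i mod 2 ^ r = j mod 2 ^ r"
  then show "bits r i = bits r j"
    by (metis bits_mod)
qed

lemma div_less_block: "i < 2 ^ r * k \<Longrightarrow> i div 2 ^ r < (k::nat)"
  by (simp add: less_mult_imp_div_less mult.commute)

text \<open>Each digit vector occurs exactly once for every \<open>a < k\<close>. This reduces
  matrix products of size \<open>2 ^ r * k\<close> to products of size \<open>k\<close> inside a
  block.\<close>

lemma sum_bits_fibre:
  assumes "v \<in> carrier_vec r"
  shows "(\<Sum>l<2 ^ r * k. if bits r l = v then f l else 0) = (\<Sum>a<k. f (index r a v))"
proof -
  have "(\<Sum>l<2 ^ r * k. if bits r l = v then f l else 0) = sum f {l \<in> {..<2 ^ r * k}. bits r l = v}"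
    by (subst sum.inter_filter) auto
  also have "{l \<in> {..<2 ^ r * k}. bits r l = v} = (\<lambda>a. index r a v) ` {..<k}"
  proof (intro equalityI subsetI)
    fix l assume "l \<in> {l \<in> {..<2 ^ r * k}. bits r l = v}"
    then show "l \<in> (\<lambda>a. index r a v) ` {..<k}"
      using index_bits[of r l] div_less_block[of l r k] by force
  qed (use assms index_less in auto)
  also have "sum f \<dots> = (\<Sum>a<k. f (index r a v))"
    by (subst sum.reindex) (auto intro!: inj_onI dest: arg_cong[where f = "\<lambda>x. x div 2 ^ r"])
  finally show ?thesis .
qed

lemma bit_vec_add_self: "v \<in> carrier_vec r \<Longrightarrow> v + v = (0\<^sub>v r :: bit vec)"
  by (intro eq_vecI) auto

lemma bit_vec_add_cancel:
  fixes u v w :: "bit vec"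
  assumes "u \<in> carrier_vec r" "v \<in> carrier_vec r" "w \<in> carrier_vec r" "u + v = u + w"
  shows "v = w"
proof -
  have "u + (u + x) = x" if "x \<in> carrier_vec r" for x
    using assms(1) that by (simp add: assoc_add_vec[symmetric] bit_vec_add_self)
  then show ?thesis
    using assms by metis
qed

lemma mat_mult_entry:
  assumes "a \<in> carrier_mat n n" "b \<in> carrier_mat n n" "i < n" "j < n"
  shows "(a * b) $$ (i, j) = (\<Sum>l<n. a $$ (i, l) * b $$ (l, j))"
  using assms by (simp add: scalar_prod_def lessThan_atLeast0)

subsection \<open>The generators of \<open>D\<close>\<close>

text \<open>The sign character of F_2; it is faithful when 2 is nonzero.\<close>

definition bit_sign :: "bit \<Rightarrow> 'a::comm_ring_1" where
  "bit_sign b = (if b = 0 then 1 else -1)"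

lemma bit_sign_add: "bit_sign (a + b) = bit_sign a * bit_sign b"
  by (cases a; cases b) (simp_all add: bit_sign_def)

lemma bit_sign_mult_self [simp]: "bit_sign a * bit_sign a = 1"
  by (simp add: bit_sign_def)

lemma bit_sign_inject:
  assumes "(2::'a::field) \<noteq> 0" "(bit_sign a :: 'a) = bit_sign b"
  shows "a = b"
proof -
  have "(1::'a) \<noteq> -1" "(-1::'a) \<noteq> 1"
    using assms(1) by (metis add.right_inverse one_add_one)+
  then show ?thesis
    using assms(2) by (cases a; cases b) (auto simp: bit_sign_def)
qed

lemma kron_carrier:
  assumes "a \<in> carrier_mat k k" "b \<in> carrier_mat (2 ^ r) (2 ^ r)"
  shows "kron a b \<in> carrier_mat (2 ^ r * k) (2 ^ r * k)"
  using assms by (auto simp: kron_def mult.commute)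

text \<open>The exponent of -1 in \<open>Amat\<close> matters only by its parity, which is digit
  \<open>s\<close> of the position. Thus the generators of D_r are the coordinate characters of
  F_2^r.\<close>

lemma kron_one_Amat:
  assumes "i < 2 ^ r * k" "j < 2 ^ r * k" "s < r"
  shows "kron (1\<^sub>m k) (Amat r s) $$ (i, j) = (if i = j then bit_sign (bits r i $ s) else 0)"
proof -
  have "i = j \<longleftrightarrow> i div 2 ^ r = j div 2 ^ r \<and> i mod 2 ^ r = j mod 2 ^ r"
    by (metis div_mult_mod_eq)
  moreover have "(-1) ^ (i mod 2 ^ r div 2 ^ s) = (bit_sign (bits r (i mod 2 ^ r) $ s) :: 'a)"
    using assms(3) by (simp add: bits_nth bit_sign_def)
  ultimately show ?thesis
    using assms div_less_block[of i r k] div_less_block[of j r k]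
    by (auto simp: kron_def Amat_def mult.commute bits_mod)
qed

lemma kron_one_right:
  assumes "i < 2 ^ r * k" "j < 2 ^ r * k" "h \<in> carrier_mat k k"
  shows "kron h (1\<^sub>m (2 ^ r)) $$ (i, j) = (if bits r i = bits r j then h $$ (i div 2 ^ r, j div 2 ^ r) else 0)"
  using assms by (auto simp: kron_def mult.commute bits_eq_iff)

lemma kron_mult_left_entry:
  assumes "h \<in> carrier_mat k k" "g \<in> carrier_mat (2 ^ r * k) (2 ^ r * k)" "i < 2 ^ r * k" "j < 2 ^ r * k"
  shows "(kron h (1\<^sub>m (2 ^ r)) * g) $$ (i, j) =
    (\<Sum>a<k. h $$ (i div 2 ^ r, a) * g $$ (index r a (bits r i), j))"
proof -
  have "(kron h (1\<^sub>m (2 ^ r)) * g) $$ (i, j) =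
      (\<Sum>l<2 ^ r * k. if bits r l = bits r i then h $$ (i div 2 ^ r, l div 2 ^ r) * g $$ (l, j) else 0)"
    using assms by (subst mat_mult_entry[OF kron_carrier]) (auto simp: kron_one_right intro!: sum.cong)
  also have "\<dots> = (\<Sum>a<k. h $$ (i div 2 ^ r, a) * g $$ (index r a (bits r i), j))"
    by (simp add: sum_bits_fibre bits_carrier)
  finally show ?thesis .
qed

lemma kron_mult_right_entry:
  assumes "h \<in> carrier_mat k k" "g \<in> carrier_mat (2 ^ r * k) (2 ^ r * k)" "i < 2 ^ r * k" "j < 2 ^ r * k"
  shows "(g * kron h (1\<^sub>m (2 ^ r))) $$ (i, j) =
    (\<Sum>a<k. g $$ (i, index r a (bits r j)) * h $$ (a, j div 2 ^ r))"
proof -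
  have "(g * kron h (1\<^sub>m (2 ^ r))) $$ (i, j) =
      (\<Sum>l<2 ^ r * k. if bits r l = bits r j then g $$ (i, l) * h $$ (l div 2 ^ r, j div 2 ^ r) else 0)"
    using assms by (subst mat_mult_entry[OF _ kron_carrier]) (auto simp: kron_one_right intro!: sum.cong)
  also have "\<dots> = (\<Sum>a<k. g $$ (i, index r a (bits r j)) * h $$ (a, j div 2 ^ r))"
    by (simp add: sum_bits_fibre bits_carrier)
  finally show ?thesis .
qed

text \<open>The inverse is written down as a Kronecker product, which avoids a determinant
  formula.\<close>

lemma kron_GLm:
  assumes "h \<in> GLm k"
  shows "kron h (1\<^sub>m (2 ^ r)) \<in> GLm (2 ^ r * k)"
proof -
  obtain h' where h': "h' \<in> GLm k" "h * h' = 1\<^sub>m k"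
    using assms by (rule GLm_inverse)
  have c: "h \<in> carrier_mat k k" "h' \<in> carrier_mat k k"
    using assms h' GLm_carrier by blast+
  then have kc: "kron h (1\<^sub>m (2 ^ r)) \<in> carrier_mat (2 ^ r * k) (2 ^ r * k)"
    "kron h' (1\<^sub>m (2 ^ r)) \<in> carrier_mat (2 ^ r * k) (2 ^ r * k)"
    by (simp_all add: kron_carrier)
  have "kron h (1\<^sub>m (2 ^ r)) * kron h' (1\<^sub>m (2 ^ r)) = 1\<^sub>m (2 ^ r * k)"
  proof (rule eq_matI)
    fix i j assume "i < dim_row (1\<^sub>m (2 ^ r * k))" "j < dim_col (1\<^sub>m (2 ^ r * k))"
    then have ij: "i < 2 ^ r * k" "j < 2 ^ r * k" by auto
    have d: "i div 2 ^ r < k" "j div 2 ^ r < k"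
      using ij div_less_block by auto
    have "(kron h (1\<^sub>m (2 ^ r)) * kron h' (1\<^sub>m (2 ^ r))) $$ (i, j) =
        (if bits r i = bits r j then \<Sum>a<k. h $$ (i div 2 ^ r, a) * h' $$ (a, j div 2 ^ r) else 0)"
      using c kc ij
      by (subst kron_mult_left_entry[of _ k]) (simp_all add: kron_one_right[of _ r k] index_less bits_carrier)
    also have "\<dots> = (if bits r i = bits r j then (h * h') $$ (i div 2 ^ r, j div 2 ^ r) else 0)"
      using mat_mult_entry[OF c d] by simp
    also have "\<dots> = 1\<^sub>m (2 ^ r * k) $$ (i, j)"
      using ij d h'(2) by (auto simp: bits_eq_iff) (metis div_mult_mod_eq)
    finally show "(kron h (1\<^sub>m (2 ^ r)) * kron h' (1\<^sub>m (2 ^ r))) $$ (i, j) = 1\<^sub>m (2 ^ r * k) $$ (i, j)" .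
  qed (use kc in auto)
  then show ?thesis
    using GLmI(1)[OF kc] by blast
qed

lemma diagonal_mult:
  fixes f g :: "nat \<Rightarrow> 'a::field"
  shows "mat n n (\<lambda>(i, j). if i = j then f i else 0) * mat n n (\<lambda>(i, j). if i = j then g i else 0)
    = mat n n (\<lambda>(i, j). if i = j then f i * g i else 0)" (is "?A * ?B = ?C")
proof (rule eq_matI)
  fix i j assume "i < dim_row ?C" "j < dim_col ?C"
  then have ij: "i < n" "j < n" by auto
  then show "(?A * ?B) $$ (i, j) = ?C $$ (i, j)"
    by (subst mat_mult_entry[of _ n]) (auto simp: mult_delta_left)
qed auto

definition generators :: "nat \<Rightarrow> nat \<Rightarrow> 'a::field mat set \<Rightarrow> 'a mat set" where
  "generators r k F = {kron (1\<^sub>m k) (Amat r s') | s'. s' < r} \<union> {kron h (1\<^sub>m (2^r)) | h. h \<in> F}"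

lemma Dpre_generators: "Dpre r k F = pgen (2 ^ r * k) (generators r k F)"
  by (simp add: Dpre_def generators_def)

lemma Amat_carrier: "Amat r s \<in> carrier_mat (2 ^ r) (2 ^ r)"
  by (simp add: Amat_def)

lemma kron_one_Amat_carrier:
  "kron (1\<^sub>m k) (Amat r s :: 'a::field mat) \<in> carrier_mat (2 ^ r * k) (2 ^ r * k)"
  by (rule kron_carrier[OF one_carrier_mat Amat_carrier])

lemma kron_one_Amat_diagonal:
  assumes "s < r"
  shows "kron (1\<^sub>m k) (Amat r s) = mat (2 ^ r * k) (2 ^ r * k)
    (\<lambda>(i, j). if i = j then bit_sign (bits r i $ s) else (0::'a::field))"
  using kron_one_Amat_carrier[of k r s, where ?'a = 'a] assms
  by (intro eq_matI) (auto simp: kron_one_Amat)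

lemma generators_GLm:
  fixes F :: "'a::field mat set"
  assumes "F \<subseteq> GLm k"
  shows "generators r k F \<subseteq> GLm (2 ^ r * k)"
proof -
  have "kron (1\<^sub>m k) (Amat r s :: 'a mat) \<in> GLm (2 ^ r * k)" if "s < r" for s
  proof (rule GLmI(1)[OF kron_one_Amat_carrier kron_one_Amat_carrier])
    show "kron (1\<^sub>m k) (Amat r s) * kron (1\<^sub>m k) (Amat r s) = (1\<^sub>m (2 ^ r * k) :: 'a mat)"
      unfolding kron_one_Amat_diagonal[OF that] diagonal_mult by (intro eq_matI) auto
  qed
  then show ?thesis
    using assms by (auto simp: generators_def intro: kron_GLm)
qed

text \<open>Products of coordinate characters give every character of F_2^r. Conjugation by a linear
  permutation turns a coordinate character into an arbitrary one, so the generators alone would not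
  suffice. The bound \<open>m\<close> on the coordinates used so far serves the induction.\<close>

lemma character_in_Dpre:
  fixes F :: "'a::field mat set"
  assumes "m \<le> r"
  shows "mat (2 ^ r * k) (2 ^ r * k)
    (\<lambda>(i, j). if i = j then bit_sign (\<Sum>s<m. u s * bits r i $ s) else 0) \<in> Dpre r k F"
  using assms
proof (induction m)
  case 0
  have "mat (2 ^ r * k) (2 ^ r * k)
      (\<lambda>(i, j). if i = j then bit_sign (\<Sum>s<0. u s * bits r i $ s) else 0) = (1\<^sub>m (2 ^ r * k) :: 'a mat)"
    by (rule eq_matI) (auto simp: bit_sign_def)
  then show ?case
    using pgen.one[of "2 ^ r * k" "generators r k F"] by (simp only: Dpre_generators)
next
  case (Suc m)
  let ?c = "mat (2 ^ r * k) (2 ^ r * k) (\<lambda>(i, j). if i = j then bit_sign (\<Sum>s<m. u s * bits r i $ s) else (0::'a))"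
  show ?case
  proof (cases "u m = 0")
    case True
    then have "mat (2 ^ r * k) (2 ^ r * k)
        (\<lambda>(i, j). if i = j then bit_sign (\<Sum>s<Suc m. u s * bits r i $ s) else (0::'a)) = ?c"
      by (intro eq_matI) auto
    then show ?thesis using Suc by simp
  next
    case False
    have gen: "kron (1\<^sub>m k) (Amat r m) \<in> generators r k F"
      using Suc.prems by (auto simp: generators_def)
    have "?c \<in> Dpre r k F"
      using Suc by simp
    then have "?c * kron (1\<^sub>m k) (Amat r m) \<in> Dpre r k F"
      unfolding Dpre_generators by (rule pgen.mult) (rule pgen.gen[OF gen])
    also have "?c * kron (1\<^sub>m k) (Amat r m) = mat (2 ^ r * k) (2 ^ r * k)
        (\<lambda>(i, j). if i = j then bit_sign (\<Sum>s<Suc m. u s * bits r i $ s) else (0::'a))"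
      using Suc.prems False unfolding kron_one_Amat_diagonal[OF Suc_le_lessD[OF Suc.prems]] diagonal_mult
      by (intro eq_matI) (auto simp: bit_sign_add)
    finally show ?thesis .
  qed
qed

subsection \<open>Permutation matrices of linear maps\<close>

definition linear_perm :: "nat \<Rightarrow> bit mat \<Rightarrow> nat \<Rightarrow> nat" where
  "linear_perm r A i = index r (i div 2 ^ r) (A *\<^sub>v bits r i)"

text \<open>The one in column \<open>j\<close> stands in row \<open>linear_perm r A j\<close>; this
  orientation makes \<open>perm_mat\<close> multiplicative rather than order reversing.\<close>

definition perm_mat :: "nat \<Rightarrow> nat \<Rightarrow> bit mat \<Rightarrow> 'a::field mat" where
  "perm_mat r k A = mat (2 ^ r * k) (2 ^ r * k) (\<lambda>(i, j). if i = linear_perm r A j then 1 else 0)"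

lemma perm_mat_carrier: "perm_mat r k A \<in> carrier_mat (2 ^ r * k) (2 ^ r * k)"
  by (simp add: perm_mat_def)

lemma linear_perm_less: "i < 2 ^ r * k \<Longrightarrow> linear_perm r A i < 2 ^ r * k"
  by (simp add: linear_perm_def index_less div_less_block)

lemma linear_perm_div [simp]: "linear_perm r A i div 2 ^ r = i div 2 ^ r"
  by (simp add: linear_perm_def)

lemma bits_linear_perm: "A \<in> carrier_mat r r \<Longrightarrow> bits r (linear_perm r A i) = A *\<^sub>v bits r i"
  by (simp add: linear_perm_def mult_mat_vec_carrier[OF _ bits_carrier])

lemma linear_perm_mult:
  assumes "A \<in> carrier_mat r r" "B \<in> carrier_mat r r"
  shows "linear_perm r A (linear_perm r B i) = linear_perm r (A * B) i"
  using assms bits_carrier[of r i]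
  by (simp add: linear_perm_def[of r A] linear_perm_def[of r "A * B"] bits_linear_perm)

lemma linear_perm_one [simp]: "linear_perm r (1\<^sub>m r) i = i"
  by (simp add: linear_perm_def bits_carrier)

lemma mult_perm_mat_entry:
  assumes "g \<in> carrier_mat (2 ^ r * k) (2 ^ r * k)" "i < 2 ^ r * k" "j < 2 ^ r * k"
  shows "(g * perm_mat r k A) $$ (i, j) = g $$ (i, linear_perm r A j)"
  using assms linear_perm_less[of j r k A]
  by (subst mat_mult_entry[OF _ perm_mat_carrier]) (simp_all add: perm_mat_def mult_delta_right)

lemma perm_mat_mult_entry:
  assumes "g \<in> carrier_mat (2 ^ r * k) (2 ^ r * k)" "i < 2 ^ r * k" "j < 2 ^ r * k"
    and A: "A \<in> carrier_mat r r" "A' \<in> carrier_mat r r" "A * A' = 1\<^sub>m r" "A' * A = 1\<^sub>m r"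
  shows "(perm_mat r k A * g) $$ (i, j) = g $$ (linear_perm r A' i, j)"
proof -
  have inv: "i = linear_perm r A l \<longleftrightarrow> l = linear_perm r A' i" for l
    using linear_perm_mult[OF A(1,2), of i] linear_perm_mult[OF A(2,1), of l] A(3,4) by auto
  show ?thesis
    using assms(1-3) linear_perm_less[of i r k A']
    by (subst mat_mult_entry[OF perm_mat_carrier]) (simp_all add: perm_mat_def inv mult_delta_left)
qed

lemma perm_mat_mult:
  assumes "A \<in> carrier_mat r r" "B \<in> carrier_mat r r"
  shows "perm_mat r k A * perm_mat r k B = perm_mat r k (A * B)"
proof (rule eq_matI)
  fix i j assume "i < dim_row (perm_mat r k (A * B))" "j < dim_col (perm_mat r k (A * B))"
  then have ij: "i < 2 ^ r * k" "j < 2 ^ r * k"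
    by (auto simp: perm_mat_def)
  then show "(perm_mat r k A * perm_mat r k B) $$ (i, j) = perm_mat r k (A * B) $$ (i, j)"
    using linear_perm_less[of j r k B] assms
    by (simp add: mult_perm_mat_entry perm_mat_carrier) (simp add: perm_mat_def linear_perm_mult)
qed (simp_all add: perm_mat_def)

lemma perm_mat_one: "perm_mat r k (1\<^sub>m r) = 1\<^sub>m (2 ^ r * k)"
  by (rule eq_matI) (auto simp: perm_mat_def)

lemma perm_mat_GLm:
  assumes "A \<in> carrier_mat r r" "A' \<in> carrier_mat r r" "A * A' = 1\<^sub>m r"
  shows "perm_mat r k A \<in> GLm (2 ^ r * k)"
  using GLmI(1)[OF perm_mat_carrier perm_mat_carrier] perm_mat_mult[OF assms(1,2)] assms(3) perm_mat_one
  by metis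

lemma perm_mat_intertwine:
  assumes A: "A \<in> carrier_mat r r" "A' \<in> carrier_mat r r" "A * A' = 1\<^sub>m r" "A' * A = 1\<^sub>m r"
    and x: "x \<in> carrier_mat (2 ^ r * k) (2 ^ r * k)" "x' \<in> carrier_mat (2 ^ r * k) (2 ^ r * k)"
    and eq: "\<And>i j. i < 2 ^ r * k \<Longrightarrow> j < 2 ^ r * k \<Longrightarrow>
      x' $$ (linear_perm r A i, linear_perm r A j) = x $$ (i, j)"
  shows "perm_mat r k A * x = x' * perm_mat r k A"
proof (rule eq_matI)
  fix i j assume "i < dim_row (x' * perm_mat r k A)" "j < dim_col (x' * perm_mat r k A)"
  then have ij: "i < 2 ^ r * k" "j < 2 ^ r * k"
    using x by (auto simp: perm_mat_def)
  have "linear_perm r A (linear_perm r A' i) = i"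
    using linear_perm_mult[OF A(1,2), of i] A(3) by simp
  then show "(perm_mat r k A * x) $$ (i, j) = (x' * perm_mat r k A) $$ (i, j)"
    using eq[OF linear_perm_less[of i r k A'] ij(2)] ij
    by (simp add: perm_mat_mult_entry[OF x(1) _ _ A] mult_perm_mat_entry[OF x(2)])
qed (use x in \<open>simp_all add: perm_mat_def\<close>)

text \<open>The entries of \<open>kron h (1\<^sub>m (2 ^ r))\<close> see digit vectors only through
  their equality, which an invertible map preserves, and the permutation keeps
  \<open>i div 2 ^ r\<close> fixed.\<close>

lemma perm_mat_kron_commute:
  assumes A: "A \<in> carrier_mat r r" "A' \<in> carrier_mat r r" "A * A' = 1\<^sub>m r" "A' * A = 1\<^sub>m r"
    and h: "h \<in> carrier_mat k k"
  shows "perm_mat r k A * kron h (1\<^sub>m (2 ^ r)) = kron h (1\<^sub>m (2 ^ r)) * perm_mat r k A"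
proof (rule perm_mat_intertwine[OF A])
  show "kron h (1\<^sub>m (2 ^ r)) \<in> carrier_mat (2 ^ r * k) (2 ^ r * k)"
    using h by (simp add: kron_carrier)
  then show "kron h (1\<^sub>m (2 ^ r)) \<in> carrier_mat (2 ^ r * k) (2 ^ r * k)" .
  fix i j assume ij: "i < 2 ^ r * k" "j < 2 ^ r * k"
  have "A' *\<^sub>v (A *\<^sub>v bits r l) = bits r l" for l
    using A bits_carrier[of r l] by (simp add: assoc_mult_mat_vec[symmetric])
  then have "A *\<^sub>v bits r i = A *\<^sub>v bits r j \<longleftrightarrow> bits r i = bits r j"
    by metis
  then show "kron h (1\<^sub>m (2 ^ r)) $$ (linear_perm r A i, linear_perm r A j) = kron h (1\<^sub>m (2 ^ r)) $$ (i, j)"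
    using ij h A(1) by (simp add: kron_one_right[of _ r k] linear_perm_less bits_linear_perm)
qed

lemma perm_mat_conj_generator:
  fixes F :: "'a::field mat set"
  assumes A: "A \<in> carrier_mat r r" "A' \<in> carrier_mat r r" "A * A' = 1\<^sub>m r" "A' * A = 1\<^sub>m r"
    and F: "F \<subseteq> GLm k" and x: "x \<in> generators r k F"
  shows "perm_mat r k A * x * perm_mat r k A' \<in> Dpre r k F"
proof -
  let ?n = "2 ^ r * k"
  have xc: "x \<in> carrier_mat ?n ?n"
    using generators_GLm[OF F] x GLm_carrier by blast
  have P: "perm_mat r k A * perm_mat r k A' = (1\<^sub>m ?n :: 'a mat)"
    using A by (simp add: perm_mat_mult perm_mat_one)
  have conj: "perm_mat r k A * x * perm_mat r k A' = x'"
    if "perm_mat r k A * x = x' * perm_mat r k A" "x' \<in> carrier_mat ?n ?n" for x'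
    using that P perm_mat_carrier[of r k, where ?'a = 'a]
    by (simp add: assoc_mult_mat[of _ ?n ?n _ ?n _ ?n])
  from x consider s where "s < r" "x = kron (1\<^sub>m k) (Amat r s)" | h where "h \<in> F" "x = kron h (1\<^sub>m (2 ^ r))"
    by (auto simp: generators_def)
  then show ?thesis
  proof cases
    case (1 s)
    \<comment> \<open>Conjugation composes a character with the inverse map \<open>A'\<close>, so
      coordinate \<open>s\<close> becomes the functional given by row \<open>s\<close> of
      \<open>A'\<close>.\<close>
    let ?x' = "mat ?n ?n (\<lambda>(i, j). if i = j then bit_sign (\<Sum>l<r. A' $$ (s, l) * bits r i $ l) else (0::'a))"
    have "perm_mat r k A * x = ?x' * perm_mat r k A"
    proof (rule perm_mat_intertwine[OF A xc])
      fix i j assume ij: "i < ?n" "j < ?n"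
      have "(\<Sum>l<r. A' $$ (s, l) * (A *\<^sub>v bits r i) $ l) = (A' *\<^sub>v (A *\<^sub>v bits r i)) $ s"
        using A(1,2) 1 bits_carrier[of r i]
        by (simp add: scalar_prod_def lessThan_atLeast0)
      also have "A' *\<^sub>v (A *\<^sub>v bits r i) = bits r i"
        using A bits_carrier[of r i] by (simp add: assoc_mult_mat_vec[symmetric])
      finally have "(\<Sum>l<r. A' $$ (s, l) * (A *\<^sub>v bits r i) $ l) = bits r i $ s" .
      moreover have "linear_perm r A i = linear_perm r A j \<longleftrightarrow> i = j"
        using linear_perm_mult[OF A(2,1)] A(4) by (metis linear_perm_one)
      ultimately show "?x' $$ (linear_perm r A i, linear_perm r A j) = x $$ (i, j)"
        using ij 1 A(1) by (auto simp: linear_perm_less bits_linear_perm kron_one_Amat)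
    qed simp
    then show ?thesis
      using conj character_in_Dpre[of r r k "\<lambda>l. A' $$ (s, l)" F] by simp
  next
    case (2 h)
    then have "perm_mat r k A * x = x * perm_mat r k A"
      using perm_mat_kron_commute[OF A] F GLm_carrier by blast
    then show ?thesis
      using conj xc x by (simp add: Dpre_generators pgen.gen)
  qed
qed

lemma perm_mat_pnormalizer:
  fixes F :: "'a::field mat set"
  assumes A: "A \<in> carrier_mat r r" "A' \<in> carrier_mat r r" "A * A' = 1\<^sub>m r" "A' * A = 1\<^sub>m r"
    and F: "F \<subseteq> GLm k"
  shows "perm_mat r k A \<in> pnormalizer (2 ^ r * k) (Dpre r k F)"
  unfolding Dpre_generators
proof (rule pnormalizer_pgenI)
  show "generators r k F \<subseteq> GLm (2 ^ r * k)"
    using F by (rule generators_GLm)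
  show "perm_mat r k A \<in> GLm (2 ^ r * k)" "perm_mat r k A' \<in> GLm (2 ^ r * k)"
    using A perm_mat_GLm by blast+
  show "perm_mat r k A * perm_mat r k A' = 1\<^sub>m (2 ^ r * k)" "perm_mat r k A' * perm_mat r k A = 1\<^sub>m (2 ^ r * k)"
    using A by (simp_all add: perm_mat_mult perm_mat_one)
  show "perm_mat r k A * x * perm_mat r k A' \<in> pgen (2 ^ r * k) (generators r k F)"
    if "x \<in> generators r k F" for x
    using perm_mat_conj_generator[OF A F that] by (simp add: Dpre_generators)
  show "perm_mat r k A' * x * perm_mat r k A \<in> pgen (2 ^ r * k) (generators r k F)"
    if "x \<in> generators r k F" for x
    using perm_mat_conj_generator[OF A(2,1,4,3) F that] by (simp add: Dpre_generators)
qed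

subsection \<open>The centralizer of \<open>D\<close>\<close>

text \<open>Homogeneity of degree \<open>w\<close> for a grading of the matrix algebra by F_2^r:
  multiplication adds degrees.\<close>

definition shift_support :: "nat \<Rightarrow> nat \<Rightarrow> 'a::zero mat \<Rightarrow> bit vec \<Rightarrow> bool" where
  "shift_support r k g w \<longleftrightarrow>
    (\<forall>i<2 ^ r * k. \<forall>j<2 ^ r * k. g $$ (i, j) \<noteq> 0 \<longrightarrow> bits r j = bits r i + w)"

text \<open>Commutation with H is exact here, not up to scalars, so that for fixed \<open>w\<close>
  all conditions besides invertibility are linear.\<close>

definition shifted_centralizer :: "nat \<Rightarrow> nat \<Rightarrow> 'a::field mat set \<Rightarrow> bit vec \<Rightarrow> 'a mat set" where
  "shifted_centralizer r k F w = {g \<in> GLm (2 ^ r * k). shift_support r k g w \<and>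
    (\<forall>h\<in>F. g * kron h (1\<^sub>m (2 ^ r)) = kron h (1\<^sub>m (2 ^ r)) * g)}"

lemma GLm_nonzero_entry:
  assumes "g \<in> GLm n" "n > 0"
  obtains i j where "i < n" "j < n" "g $$ (i, j) \<noteq> 0"
proof -
  have "\<not> (\<forall>i<n. \<forall>j<n. g $$ (i, j) = 0)"
  proof
    assume "\<forall>i<n. \<forall>j<n. g $$ (i, j) = 0"
    then have "1 \<cdot>\<^sub>m g = 0\<^sub>m n n"
      using GLm_carrier[OF assms(1)] by (intro eq_matI) auto
    then show False
      using GLm_smult_eq_zero[OF assms] by fastforce
  qed
  then show thesis using that by blast
qed

lemma shift_support_mult:
  fixes a b :: "'a::field mat"
  assumes "a \<in> carrier_mat (2 ^ r * k) (2 ^ r * k)" "b \<in> carrier_mat (2 ^ r * k) (2 ^ r * k)"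
    and "shift_support r k a w" "shift_support r k b u" "w \<in> carrier_vec r" "u \<in> carrier_vec r"
  shows "shift_support r k (a * b) (w + u)"
  unfolding shift_support_def
proof (intro allI impI)
  fix i j assume ij: "i < 2 ^ r * k" "j < 2 ^ r * k" and nz: "(a * b) $$ (i, j) \<noteq> 0"
  have "(\<Sum>l<2 ^ r * k. a $$ (i, l) * b $$ (l, j)) \<noteq> 0"
    using nz mat_mult_entry[OF assms(1,2) ij] by simp
  then obtain l where l: "l < 2 ^ r * k" "a $$ (i, l) * b $$ (l, j) \<noteq> 0"
    by (metis (no_types, lifting) lessThan_iff sum.neutral)
  then have "bits r l = bits r i + w" "bits r j = bits r l + u"
    using assms(3,4) ij by (auto simp: shift_support_def)
  then show "bits r j = bits r i + (w + u)"
    using assms(5,6) bits_carrier[of r i] by simp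
qed

text \<open>An invertible matrix of positive size has a nonzero entry, and its position determines
  the shift.\<close>

lemma shift_support_unique:
  fixes g :: "'a::field mat"
  assumes "g \<in> GLm (2 ^ r * k)" "k > 0" "shift_support r k g w" "shift_support r k g u"
    and "w \<in> carrier_vec r" "u \<in> carrier_vec r"
  shows "w = u"
proof -
  obtain i j where "i < 2 ^ r * k" "j < 2 ^ r * k" "g $$ (i, j) \<noteq> 0"
    using GLm_nonzero_entry[OF assms(1)] assms(2) by auto
  then have "bits r i + w = bits r i + u"
    using assms(3,4) by (metis shift_support_def)
  then show ?thesis
    using bit_vec_add_cancel bits_carrier assms(5,6) by blast
qed

text \<open>A linear relabelling of positions carries differences of digit vectors along, so the
  normalizer acts on shifts by the natural representation.\<close>

lemma shift_support_perm_conj: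
  fixes g :: "'a::field mat"
  assumes A: "A \<in> carrier_mat r r" "A' \<in> carrier_mat r r" "A * A' = 1\<^sub>m r" "A' * A = 1\<^sub>m r"
    and g: "g \<in> carrier_mat (2 ^ r * k) (2 ^ r * k)" "shift_support r k g w" "w \<in> carrier_vec r"
  shows "shift_support r k (perm_mat r k A * g * perm_mat r k A') (A *\<^sub>v w)"
  unfolding shift_support_def
proof (intro allI impI)
  fix i j assume ij: "i < 2 ^ r * k" "j < 2 ^ r * k"
    and nz: "(perm_mat r k A * g * perm_mat r k A') $$ (i, j) \<noteq> 0"
  have Pg: "perm_mat r k A * g \<in> carrier_mat (2 ^ r * k) (2 ^ r * k)"
    using g perm_mat_carrier[of r k A, where ?'a = 'a] by simp
  have "(perm_mat r k A * g * perm_mat r k A') $$ (i, j) = (perm_mat r k A * g) $$ (i, linear_perm r A' j)"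
    by (rule mult_perm_mat_entry[OF Pg ij])
  also have "\<dots> = g $$ (linear_perm r A' i, linear_perm r A' j)"
    by (rule perm_mat_mult_entry[OF g(1) ij(1) linear_perm_less[OF ij(2)] A])
  finally have "bits r (linear_perm r A' j) = bits r (linear_perm r A' i) + w"
    using nz g(2) ij linear_perm_less by (auto simp: shift_support_def)
  then have "A *\<^sub>v (A' *\<^sub>v bits r j) = A *\<^sub>v (A' *\<^sub>v bits r i + w)"
    using A(2) by (simp add: bits_linear_perm)
  also have "\<dots> = A *\<^sub>v (A' *\<^sub>v bits r i) + A *\<^sub>v w"
    using A g(3) bits_carrier[of r i] by (intro mult_add_distrib_mat_vec) auto
  finally show "bits r j = bits r i + A *\<^sub>v w"
    using A bits_carrier[of r] by (simp add: assoc_mult_mat_vec[symmetric, where ?n\<^sub>1 = r and ?n\<^sub>2 = r and ?n\<^sub>3 = r])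
qed

lemma diagonal_mult_entry:
  fixes g :: "'a::field mat"
  assumes g: "g \<in> carrier_mat (2 ^ r * k) (2 ^ r * k)" and ij: "i < 2 ^ r * k" "j < 2 ^ r * k" and s: "s < r"
  shows "(g * kron (1\<^sub>m k) (Amat r s)) $$ (i, j) = g $$ (i, j) * bit_sign (bits r j $ s)"
    "(kron (1\<^sub>m k) (Amat r s) * g) $$ (i, j) = bit_sign (bits r i $ s) * g $$ (i, j)"
  using assms
  by (simp_all add: mat_mult_entry[OF g kron_one_Amat_carrier ij] mat_mult_entry[OF kron_one_Amat_carrier g ij]
      kron_one_Amat mult_delta_left mult_delta_right del: index_mult_mat)

text \<open>Conjugation by the diagonal matrix of coordinate \<open>s\<close> multiplies entry
  \<open>(i, j)\<close> by the sign of digit \<open>s\<close> of \<open>bits r i + bits r j\<close>.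
  A common scalar forces this sign to agree at all nonzero entries, and 2 being nonzero lets the
  digit be recovered from its sign.\<close>

lemma centralizer_Amat_iff:
  fixes g :: "'a::field mat"
  assumes g: "g \<in> GLm (2 ^ r * k)" and k: "k > 0" and char: "(2::'a) \<noteq> 0"
  shows "(\<forall>s<r. \<exists>c. g * kron (1\<^sub>m k) (Amat r s) = c \<cdot>\<^sub>m (kron (1\<^sub>m k) (Amat r s) * g)) \<longleftrightarrow>
    (\<exists>w\<in>carrier_vec r. shift_support r k g w)" (is "?L \<longleftrightarrow> ?R")
proof
  have gc: "g \<in> carrier_mat (2 ^ r * k) (2 ^ r * k)"
    using g by (rule GLm_carrier)
  {
    assume L: ?L
    \<comment> \<open>One nonzero entry fixes the candidate shift
      \<open>bits r j0 + bits r i0\<close>; every other nonzero entry is compared with it.\<close>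
    obtain i0 j0 where ij0: "i0 < 2 ^ r * k" "j0 < 2 ^ r * k" "g $$ (i0, j0) \<noteq> 0"
      using GLm_nonzero_entry[OF g] k by auto
    have c: "bits r j $ s + bits r i $ s = bits r j0 $ s + bits r i0 $ s"
      if s: "s < r" and ij: "i < 2 ^ r * k" "j < 2 ^ r * k" "g $$ (i, j) \<noteq> 0" for s i j
    proof -
      obtain c where c: "g * kron (1\<^sub>m k) (Amat r s) = c \<cdot>\<^sub>m (kron (1\<^sub>m k) (Amat r s) * g)"
        using L s by blast
      have "c = bit_sign (bits r b $ s + bits r a $ s)"
        if ab: "a < 2 ^ r * k" "b < 2 ^ r * k" "g $$ (a, b) \<noteq> 0" for a b
      proof -
        have "(g * kron (1\<^sub>m k) (Amat r s)) $$ (a, b) = c * (kron (1\<^sub>m k) (Amat r s) * g) $$ (a, b)"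
          using ab gc kron_one_Amat_carrier[of k r s, where ?'a = 'a] by (subst c) auto
        then have "bit_sign (bits r b $ s) = c * bit_sign (bits r a $ s)"
          using ab by (simp add: diagonal_mult_entry[OF gc ab(1,2) s] del: index_mult_mat)
        then have "bit_sign (bits r b $ s) * bit_sign (bits r a $ s) = c * (bit_sign (bits r a $ s) * bit_sign (bits r a $ s))"
          by (simp add: mult.assoc del: bit_sign_mult_self)
        then show ?thesis by (simp add: bit_sign_add)
      qed
      then have "(bit_sign (bits r j $ s + bits r i $ s) :: 'a) = bit_sign (bits r j0 $ s + bits r i0 $ s)"
        using ij ij0 by metis
      then show ?thesis
        using bit_sign_inject[OF char] by blast
    qed
    have "bits r j = bits r i + (bits r j0 + bits r i0)"
      if "i < 2 ^ r * k" "j < 2 ^ r * k" "g $$ (i, j) \<noteq> 0" for i j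
    proof (rule eq_vecI)
      fix s assume "s < dim_vec (bits r i + (bits r j0 + bits r i0))"
      then have s: "s < r" by simp
      have "bits r j $ s = bits r i $ s + (bits r j $ s + bits r i $ s)"
        by (cases "bits r i $ s"; cases "bits r j $ s") simp_all
      then show "bits r j $ s = (bits r i + (bits r j0 + bits r i0)) $ s"
        using c[OF s that] s by simp
    qed simp
    moreover have "bits r j0 + bits r i0 \<in> carrier_vec r"
      using bits_carrier by auto
    ultimately show ?R
      unfolding shift_support_def by blast
  }
  {
    assume ?R
    then obtain w where w: "w \<in> carrier_vec r" "shift_support r k g w" by blast
    have "g * kron (1\<^sub>m k) (Amat r s) = bit_sign (w $ s) \<cdot>\<^sub>m (kron (1\<^sub>m k) (Amat r s) * g)" (is "?a = ?b")
      if s: "s < r" for s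
    proof (rule eq_matI)
      fix i j assume "i < dim_row ?b" "j < dim_col ?b"
      then have ij: "i < 2 ^ r * k" "j < 2 ^ r * k"
        using gc kron_one_Amat_carrier[of k r s, where ?'a = 'a] by auto
      have "g $$ (i, j) * bit_sign (bits r j $ s) = bit_sign (w $ s) * (bit_sign (bits r i $ s) * g $$ (i, j))"
      proof (cases "g $$ (i, j) = 0")
        case False
        then have "bits r j = bits r i + w"
          using w(2) ij by (simp add: shift_support_def)
        then show ?thesis
          using s w(1) by (simp add: bit_sign_add)
      qed simp
      then show "?a $$ (i, j) = ?b $$ (i, j)"
        using ij gc kron_one_Amat_carrier[of k r s, where ?'a = 'a]
        by (subst index_smult_mat) (auto simp: diagonal_mult_entry[OF gc ij s] simp del: index_mult_mat(1))
    qed (use gc kron_one_Amat_carrier[of k r s, where ?'a = 'a] in auto)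
    then show ?L by blast
  }
qed

text \<open>Compares \<open>g\<close> with its block at the zero coordinate row, which lies in the projective
  centralizer of \<open>F\<close>.\<close>
lemma centralizer_kron_commute:
  fixes F :: "'a::field mat set"
  assumes F: "F \<subseteq> GLm k" and k: "k > 0" and g: "g \<in> GLm (2 ^ r * k)"
    and w: "w \<in> carrier_vec r" "shift_support r k g w"
    and pc: "\<forall>h\<in>F. \<exists>c. g * kron h (1\<^sub>m (2 ^ r)) = c \<cdot>\<^sub>m (kron h (1\<^sub>m (2 ^ r)) * g)"
    and comm: "\<And>x h. x \<in> pcentralizer k F \<Longrightarrow> h \<in> F \<Longrightarrow> x * h = h * x"
    and h: "h \<in> F"
  shows "g * kron h (1\<^sub>m (2 ^ r)) = kron h (1\<^sub>m (2 ^ r)) * g"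
proof -
  let ?n = "2 ^ r * k"
  have gc: "g \<in> carrier_mat ?n ?n"
    using g by (rule GLm_carrier)
  obtain g' where g': "g' \<in> GLm ?n" "g * g' = 1\<^sub>m ?n"
    using g by (rule GLm_inverse)
  have g'c: "g' \<in> carrier_mat ?n ?n"
    using g'(1) by (rule GLm_carrier)
  define G where "G = mat k k (\<lambda>(a, b). g $$ (index r a (0\<^sub>v r), index r b w))"
  \<comment> \<open>The opposite block of the inverse. Nothing about the support of
    \<open>g'\<close> is required: the support of \<open>g\<close> already confines the sum in
    \<open>g * g'\<close> to positions with digit vector \<open>w\<close>.\<close>
  define G' where "G' = mat k k (\<lambda>(a, b). g' $$ (index r a w, index r b (0\<^sub>v r)))"
  have c: "G \<in> carrier_mat k k" "G' \<in> carrier_mat k k"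
    by (auto simp: G_def G'_def)
  have "G * G' = 1\<^sub>m k"
  proof (rule eq_matI)
    fix a b assume "a < dim_row (1\<^sub>m k)" "b < dim_col (1\<^sub>m k)"
    then have ab: "a < k" "b < k" by auto
    let ?i = "index r a (0\<^sub>v r)" and ?j = "index r b (0\<^sub>v r)"
    have ij: "?i < ?n" "?j < ?n"
      using ab index_less by auto
    have inj: "?i = ?j \<longleftrightarrow> a = b"
      by (metis index_div)
    have supp: "g $$ (?i, l) = 0" if "l < ?n" "bits r l \<noteq> w" for l
      using w that ij by (auto simp: shift_support_def)
    have "(G * G') $$ (a, b) = (\<Sum>l<k. g $$ (?i, index r l w) * g' $$ (index r l w, ?j))"
      using ab by (subst mat_mult_entry[OF c ab]) (simp add: G_def G'_def)
    also have "\<dots> = (\<Sum>l<?n. if bits r l = w then g $$ (?i, l) * g' $$ (l, ?j) else 0)"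
      by (simp add: sum_bits_fibre[OF w(1)])
    also have "\<dots> = (\<Sum>l<?n. g $$ (?i, l) * g' $$ (l, ?j))"
      using supp by (intro sum.cong) auto
    also have "\<dots> = (g * g') $$ (?i, ?j)"
      by (rule mat_mult_entry[OF gc g'c ij, symmetric])
    also have "\<dots> = 1\<^sub>m k $$ (a, b)"
      using ij ab inj by (simp add: g'(2))
    finally show "(G * G') $$ (a, b) = 1\<^sub>m k $$ (a, b)" .
  qed (use c in auto)
  then have G: "G \<in> GLm k"
    using GLmI(1)[OF c] by blast
  have block: "G * x = d \<cdot>\<^sub>m (x * G)"
    if x: "x \<in> carrier_mat k k" and d: "g * kron x (1\<^sub>m (2 ^ r)) = d \<cdot>\<^sub>m (kron x (1\<^sub>m (2 ^ r)) * g)" for x d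
  proof (rule eq_matI)
    fix a b assume "a < dim_row (d \<cdot>\<^sub>m (x * G))" "b < dim_col (d \<cdot>\<^sub>m (x * G))"
    then have ab: "a < k" "b < k" using x c by auto
    let ?i = "index r a (0\<^sub>v r)" and ?j = "index r b w"
    have ij: "?i < ?n" "?j < ?n"
      using ab index_less by auto
    have "(G * x) $$ (a, b) = (\<Sum>l<k. g $$ (?i, index r l w) * x $$ (l, b))"
      using ab by (subst mat_mult_entry[OF c(1) x ab]) (simp add: G_def)
    also have "\<dots> = (g * kron x (1\<^sub>m (2 ^ r))) $$ (?i, ?j)"
      using w(1) by (subst kron_mult_right_entry[OF x gc ij]) simp
    also have "\<dots> = d * (kron x (1\<^sub>m (2 ^ r)) * g) $$ (?i, ?j)"
      using ij gc kron_carrier[OF x one_carrier_mat[of "2 ^ r"]] by (subst d) auto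
    also have "(kron x (1\<^sub>m (2 ^ r)) * g) $$ (?i, ?j) = (\<Sum>l<k. x $$ (a, l) * g $$ (index r l (0\<^sub>v r), ?j))"
      by (subst kron_mult_left_entry[OF x gc ij]) simp
    also have "\<dots> = (x * G) $$ (a, b)"
      using ab by (subst mat_mult_entry[OF x c(1) ab]) (simp add: G_def)
    finally show "(G * x) $$ (a, b) = (d \<cdot>\<^sub>m (x * G)) $$ (a, b)"
      using ab x c by simp
  qed (use x c in auto)
  have "G \<in> pcentralizer k F"
    using G block pc F GLm_carrier unfolding pcentralizer_def by blast
  then have Gh: "G * h = h * G"
    using comm h by blast
  obtain d where d: "g * kron h (1\<^sub>m (2 ^ r)) = d \<cdot>\<^sub>m (kron h (1\<^sub>m (2 ^ r)) * g)"
    using pc h by blast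
  have hG: "h \<in> GLm k" using h F by blast
  \<comment> \<open>The scalar \<open>d\<close> of the whole matrix is also that of its block
    \<open>G\<close>. Since \<open>G\<close> is invertible and commutes exactly with
    \<open>h\<close>, it must be 1.\<close>
  have "1 \<cdot>\<^sub>m (h * G) = d \<cdot>\<^sub>m (h * G)"
    using block[OF GLm_carrier[OF hG] d] Gh by (simp add: one_smult_mat)
  then have "d = 1"
    using GLm_smult_cancel[OF GLm_mult[OF hG G] k] by metis
  then show ?thesis
    using d by (simp add: one_smult_mat)
qed

lemma pcentralizer_Dpre:
  fixes F :: "'a::field mat set"
  assumes F: "F \<subseteq> GLm k" and k: "k > 0" and char: "(2::'a) \<noteq> 0"
    and comm: "\<And>x h. x \<in> pcentralizer k F \<Longrightarrow> h \<in> F \<Longrightarrow> x * h = h * x"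
  shows "pcentralizer (2 ^ r * k) (Dpre r k F) = (\<Union>w\<in>carrier_vec r. shifted_centralizer r k F w)"
proof -
  have "pcentralizer (2 ^ r * k) (Dpre r k F) = pcentralizer (2 ^ r * k) (generators r k F)"
    using pcentralizer_pgen[OF generators_GLm[OF F]] k by (simp add: Dpre_generators)
  also have "\<dots> = (\<Union>w\<in>carrier_vec r. shifted_centralizer r k F w)"
  proof (intro equalityI subsetI)
    fix g assume "g \<in> pcentralizer (2 ^ r * k) (generators r k F)"
    then have g: "g \<in> GLm (2 ^ r * k)"
      and A: "\<forall>s<r. \<exists>c. g * kron (1\<^sub>m k) (Amat r s) = c \<cdot>\<^sub>m (kron (1\<^sub>m k) (Amat r s) * g)"
      and h: "\<forall>h\<in>F. \<exists>c. g * kron h (1\<^sub>m (2 ^ r)) = c \<cdot>\<^sub>m (kron h (1\<^sub>m (2 ^ r)) * g)"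
      by (auto simp: pcentralizer_def generators_def)
    obtain w where w: "w \<in> carrier_vec r" "shift_support r k g w"
      using A centralizer_Amat_iff[OF g k char] by blast
    then show "g \<in> (\<Union>w\<in>carrier_vec r. shifted_centralizer r k F w)"
      using g centralizer_kron_commute[OF F k g w h comm] by (auto simp: shifted_centralizer_def)
  next
    fix g assume "g \<in> (\<Union>w\<in>carrier_vec r. shifted_centralizer r k F w)"
    then obtain w where w: "w \<in> carrier_vec r" "shift_support r k g w"
      and g: "g \<in> GLm (2 ^ r * k)"
      and h: "\<forall>h\<in>F. g * kron h (1\<^sub>m (2 ^ r)) = 1 \<cdot>\<^sub>m (kron h (1\<^sub>m (2 ^ r)) * g)"
      by (auto simp: shifted_centralizer_def one_smult_mat)
    have "\<forall>s<r. \<exists>c. g * kron (1\<^sub>m k) (Amat r s) = c \<cdot>\<^sub>m (kron (1\<^sub>m k) (Amat r s) * g)"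
      using w centralizer_Amat_iff[OF g k char] by blast
    then show "g \<in> pcentralizer (2 ^ r * k) (generators r k F)"
      using g h by (fastforce simp: pcentralizer_def generators_def)
  qed
  finally show ?thesis .
qed

section \<open>The identity component of the centralizer\<close>

lemma one_shifted_centralizer:
  fixes F :: "'a::field mat set"
  assumes "F \<subseteq> GLm k"
  shows "1\<^sub>m (2 ^ r * k) \<in> shifted_centralizer r k F (0\<^sub>v r)"
proof -
  have "kron h (1\<^sub>m (2 ^ r)) \<in> carrier_mat (2 ^ r * k) (2 ^ r * k)" if "h \<in> F" for h
    using assms that kron_GLm GLm_carrier by blast
  moreover have "bits r i + 0\<^sub>v r = bits r i" for i
    using bits_carrier by simp
  ultimately show ?thesis
    using one_GLm by (fastforce simp: shifted_centralizer_def shift_support_def)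
qed

text \<open>A vanishing condition on entries and exact commutation both persist along the line
  through two solutions, so only invertibility can fail on it.\<close>

lemma connected_shifted_centralizer_zero:
  fixes F :: "'a::field mat set"
  assumes inf: "infinite (UNIV :: 'a set)" and F: "F \<subseteq> GLm k"
  shows "connectedin (zariski_GL (2 ^ r * k)) (shifted_centralizer r k F (0\<^sub>v r))"
proof (rule connectedin_zariski_affine[OF inf])
  let ?n = "2 ^ r * k"
  show "shifted_centralizer r k F (0\<^sub>v r) \<subseteq> GLm ?n"
    by (auto simp: shifted_centralizer_def)
  fix x y t
  assume x: "x \<in> shifted_centralizer r k F (0\<^sub>v r)" and y: "y \<in> shifted_centralizer r k F (0\<^sub>v r)"
    and G: "x + t \<cdot>\<^sub>m (y - x) \<in> GLm ?n"
  have c: "x \<in> carrier_mat ?n ?n" "y \<in> carrier_mat ?n ?n"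
    using x y GLm_carrier by (auto simp: shifted_centralizer_def)
  then have d: "y - x \<in> carrier_mat ?n ?n" by auto
  have "shift_support r k (x + t \<cdot>\<^sub>m (y - x)) (0\<^sub>v r)"
    unfolding shift_support_def
  proof (intro allI impI)
    fix i j assume ij: "i < ?n" "j < ?n" and nz: "(x + t \<cdot>\<^sub>m (y - x)) $$ (i, j) \<noteq> 0"
    have "x $$ (i, j) \<noteq> 0 \<or> y $$ (i, j) \<noteq> 0"
      using nz ij c by auto
    then show "bits r j = bits r i + 0\<^sub>v r"
      using x y ij by (auto simp: shifted_centralizer_def shift_support_def)
  qed
  moreover have "(x + t \<cdot>\<^sub>m (y - x)) * kron h (1\<^sub>m (2 ^ r)) = kron h (1\<^sub>m (2 ^ r)) * (x + t \<cdot>\<^sub>m (y - x))"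
    if h: "h \<in> F" for h
  proof -
    let ?h = "kron h (1\<^sub>m (2 ^ r))"
    have hc: "?h \<in> carrier_mat ?n ?n"
      using h F kron_GLm GLm_carrier by blast
    have com: "x * ?h = ?h * x" "y * ?h = ?h * y"
      using x y h by (auto simp: shifted_centralizer_def)
    have "(x + t \<cdot>\<^sub>m (y - x)) * ?h = x * ?h + t \<cdot>\<^sub>m (y * ?h - x * ?h)"
      using c d hc by (simp add: add_mult_distrib_mat[of _ ?n ?n] minus_mult_distrib_mat[of _ ?n ?n] smult_mult_mat[of _ ?n])
    also have "\<dots> = ?h * (x + t \<cdot>\<^sub>m (y - x))"
      using c d hc by (simp add: com mult_add_distrib_mat[of _ ?n ?n] mult_minus_distrib_mat[of _ ?n ?n] smult_mult_mat[of _ ?n])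
    finally show ?thesis .
  qed
  ultimately show "x + t \<cdot>\<^sub>m (y - x) \<in> shifted_centralizer r k F (0\<^sub>v r)"
    using G by (auto simp: shifted_centralizer_def)
qed

lemma identity_component_shifted:
  fixes F :: "'a::field mat set"
  assumes inf: "infinite (UNIV :: 'a set)" and F: "F \<subseteq> GLm k" and k: "k > 0"
    and C: "C = (\<Union>w\<in>carrier_vec r. shifted_centralizer r k F w)"
  shows "identity_component (2 ^ r * k) C = shifted_centralizer r k F (0\<^sub>v r)"
proof (intro equalityI subsetI)
  let ?n = "2 ^ r * k"
  have one: "1\<^sub>m ?n \<in> shifted_centralizer r k F (0\<^sub>v r)"
    using F by (rule one_shifted_centralizer)
  {
    fix y assume y: "y \<in> shifted_centralizer r k F (0\<^sub>v r)"
    have "shifted_centralizer r k F (0\<^sub>v r) \<subseteq> C"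
      using C by auto
    then have "connectedin (subtopology (zariski_GL ?n) C) (shifted_centralizer r k F (0\<^sub>v r))"
      using connected_shifted_centralizer_zero[OF inf F] by (simp add: connectedin_subtopology)
    then show "y \<in> identity_component ?n C"
      using y one by (auto simp: identity_component_def connected_component_of_def)
  }
  {
    fix y assume "y \<in> identity_component ?n C"
    then obtain T where T: "connectedin (zariski_GL ?n) T" "T \<subseteq> C" "1\<^sub>m ?n \<in> T" "y \<in> T"
      by (auto simp: identity_component_def connected_component_of_def connectedin_subtopology)
    \<comment> \<open>With \<open>P = id\<close> the set asks for a nonzero entry in a diagonal
      block, with \<open>P = Not\<close> for one outside. On the centralizer these open sets
      separate shift 0 from all other shifts.\<close>
    define E where "E P = {g \<in> GLm ?n. \<exists>i<?n. \<exists>j<?n. (if P (bits r i = bits r j) then g $$ (i, j) else (0::'a)) \<noteq> 0}"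
      for P
    have openE: "openin (zariski_GL ?n) (E P)" for P
      unfolding E_def
    proof (rule openin_zariski_nonzero)
      fix i j assume "i < ?n" "j < ?n"
      then show "(\<lambda>g. if P (bits r i = bits r j) then g $$ (i, j) else 0) \<in> polyfun ?n"
        by (cases "P (bits r i = bits r j)") (auto intro: polyfun.entry polyfun.const)
    qed
    have zero: "bits r j = bits r i + w \<Longrightarrow> bits r i = bits r j \<longleftrightarrow> w = 0\<^sub>v r"
      if "w \<in> carrier_vec r" for i j w
      using bit_vec_add_cancel[OF bits_carrier that zero_carrier_vec, of i] bits_carrier[of r i] by auto
    have mem: "g \<in> E P \<longleftrightarrow> P (w = 0\<^sub>v r)" if w: "w \<in> carrier_vec r" and g: "g \<in> shifted_centralizer r k F w" for g w P
    proof -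
      have gG: "g \<in> GLm ?n" and supp: "shift_support r k g w"
        using g by (auto simp: shifted_centralizer_def)
      obtain i j where "i < ?n" "j < ?n" "g $$ (i, j) \<noteq> 0"
        using GLm_nonzero_entry[OF gG] k by auto
      moreover have "bits r i = bits r j \<longleftrightarrow> w = 0\<^sub>v r" if "i < ?n" "j < ?n" "g $$ (i, j) \<noteq> 0" for i j
        using that supp zero[OF w] by (auto simp: shift_support_def)
      ultimately show ?thesis
        using gG unfolding E_def by (smt (verit, best) mem_Collect_eq)
    qed
    have CE: "C \<subseteq> E id \<union> E Not" "E id \<inter> E Not \<inter> C = {}"
      using mem[where P = id] mem[where P = Not] unfolding C id_apply by blast+
    have "1\<^sub>m ?n \<in> E id"
      using mem[OF _ one] by simp
    then have "E Not \<inter> T = {}"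
      using connectedinD[OF T(1) openE openE, of id Not] T(2,3) CE by blast
    then have "y \<notin> E Not"
      using T(4) by blast
    then show "y \<in> shifted_centralizer r k F (0\<^sub>v r)"
      using mem[where P = Not] C T(2,4) by blast
  }
qed

section \<open>Transvections over F_2 and their action on the shifts\<close>

lemma mat_eq_by_vec:
  fixes A B :: "'a::comm_ring_1 mat"
  assumes "A \<in> carrier_mat n n" "B \<in> carrier_mat n n"
    and eq: "\<And>x. x \<in> carrier_vec n \<Longrightarrow> A *\<^sub>v x = B *\<^sub>v x"
  shows "A = B"
proof (rule eq_matI)
  fix i j assume "i < dim_row B" "j < dim_col B"
  then have ij: "i < n" "j < n" using assms(2) by auto
  then have entry: "X $$ (i, j) = (X *\<^sub>v unit_vec n j) $ i" if "X \<in> carrier_mat n n" for X :: "'a mat"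
    using that by (simp add: scalar_prod_right_unit)
  show "A $$ (i, j) = B $$ (i, j)"
    using entry[OF assms(1)] entry[OF assms(2)] eq by simp
qed (use assms in auto)

text \<open>The map adds \<open>f \<bullet> x\<close> times \<open>u = v + w\<close> to
  \<open>x\<close>. The value 1 of \<open>f\<close> at \<open>v\<close> sends \<open>v\<close> to
  \<open>w\<close>; the value 0 at \<open>u\<close> makes the map an involution, hence its own
  inverse. If \<open>v = w\<close>, it is the identity.\<close>

lemma transvection_exists:
  fixes v w :: "bit vec"
  assumes v: "v \<in> carrier_vec r" "v \<noteq> 0\<^sub>v r" and w: "w \<in> carrier_vec r" "w \<noteq> 0\<^sub>v r"
  obtains A where "A \<in> carrier_mat r r" "A * A = 1\<^sub>m r" "A *\<^sub>v v = w"
proof -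
  have nz: "\<exists>i<r. x $ i = 1" if "x \<in> carrier_vec r" "x \<noteq> 0\<^sub>v r" for x :: "bit vec"
  proof (rule ccontr)
    assume "\<not> ?thesis"
    then have "x = 0\<^sub>v r"
      using that(1) by (intro eq_vecI) auto
    then show False using that(2) by simp
  qed
  \<comment> \<open>If some coordinate is 1 in both vectors, it serves as functional. Otherwise one
    coordinate is taken where \<open>v\<close> is 1 and one where \<open>w\<close> is 1; each sees
    only one of the vectors, so their sum is 1 on both.\<close>
  obtain f where f: "f \<in> carrier_vec r" "f \<bullet> v = 1" "f \<bullet> w = 1"
  proof (cases "\<exists>i<r. v $ i = 1 \<and> w $ i = 1")
    case True
    then obtain i where "i < r" "v $ i = 1" "w $ i = 1" by blast
    then show thesis
      using that[of "unit_vec r i"] v w by simp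
  next
    case False
    obtain i j where ij: "i < r" "v $ i = 1" "j < r" "w $ j = 1"
      using nz v w by blast
    then have "w $ i = 0" "v $ j = 0"
      using False by (metis bit_not_one_iff)+
    then show thesis
      using that[of "unit_vec r i + unit_vec r j"] v w ij
      by (simp add: add_scalar_prod_distrib[of _ r])
  qed
  define u where "u = v + w"
  have u: "u \<in> carrier_vec r" using v w by (simp add: u_def)
  have fu: "f \<bullet> u = 0"
    using f v w by (simp add: u_def scalar_prod_add_distrib[of _ r])
  define A where "A = mat r r (\<lambda>(i, j). (if i = j then 1 else 0) + u $ i * f $ j)"
  have A: "A \<in> carrier_mat r r" by (simp add: A_def)
  have act: "A *\<^sub>v x = x + (f \<bullet> x) \<cdot>\<^sub>v u" if x: "x \<in> carrier_vec r" for x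
  proof (rule eq_vecI)
    fix i assume "i < dim_vec (x + (f \<bullet> x) \<cdot>\<^sub>v u)"
    then have i: "i < r" using u by simp
    have "(A *\<^sub>v x) $ i = (\<Sum>j<r. A $$ (i, j) * x $ j)"
      using A i x by (simp add: scalar_prod_def lessThan_atLeast0)
    also have "\<dots> = (\<Sum>j<r. (if i = j then x $ j else 0) + u $ i * (f $ j * x $ j))"
      using i by (intro sum.cong) (auto simp: A_def algebra_simps)
    also have "\<dots> = x $ i + u $ i * (\<Sum>j<r. f $ j * x $ j)"
      using i by (simp add: sum.distrib sum_distrib_left)
    also have "(\<Sum>j<r. f $ j * x $ j) = f \<bullet> x"
      using x by (simp add: scalar_prod_def lessThan_atLeast0)
    finally show "(A *\<^sub>v x) $ i = (x + (f \<bullet> x) \<cdot>\<^sub>v u) $ i"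
      using i u x by (simp add: mult.commute)
  qed (use A x u in simp)
  have "A *\<^sub>v v = v + (v + w)"
    using act[OF v(1)] f by (simp add: u_def)
  also have "\<dots> = w"
    using v w by (simp add: assoc_add_vec[symmetric] bit_vec_add_self)
  finally have "A *\<^sub>v v = w" .
  moreover have "A * A = 1\<^sub>m r"
  proof -
    have "A *\<^sub>v (A *\<^sub>v x) = x" if x: "x \<in> carrier_vec r" for x
    proof -
      have "f \<bullet> (x + (f \<bullet> x) \<cdot>\<^sub>v u) = f \<bullet> x"
        using f(1) x u fu by (simp add: scalar_prod_add_distrib[of _ r])
      then have "A *\<^sub>v (A *\<^sub>v x) = x + (f \<bullet> x) \<cdot>\<^sub>v u + (f \<bullet> x) \<cdot>\<^sub>v u"
        using x u by (simp add: act)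
      also have "\<dots> = x"
        using x u by (simp add: assoc_add_vec[of _ r] bit_vec_add_self)
      finally show ?thesis .
    qed
    then show ?thesis
      using A by (intro mat_eq_by_vec[of _ r]) (auto simp: assoc_mult_mat_vec[of _ r r])
  qed
  ultimately show thesis
    using that A by blast
qed

lemma shifted_centralizer_perm_conj:
  fixes F :: "'a::field mat set"
  assumes A: "A \<in> carrier_mat r r" "A' \<in> carrier_mat r r" "A * A' = 1\<^sub>m r" "A' * A = 1\<^sub>m r"
    and F: "F \<subseteq> GLm k" and w: "w \<in> carrier_vec r" and g: "g \<in> shifted_centralizer r k F w"
  shows "perm_mat r k A * g * perm_mat r k A' \<in> shifted_centralizer r k F (A *\<^sub>v w)"
proof -
  let ?n = "2 ^ r * k" and ?P = "perm_mat r k A :: 'a mat" and ?P' = "perm_mat r k A' :: 'a mat"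
  have gG: "g \<in> GLm ?n" and supp: "shift_support r k g w"
    using g by (auto simp: shifted_centralizer_def)
  have gc: "g \<in> carrier_mat ?n ?n"
    using gG by (rule GLm_carrier)
  have P: "?P \<in> carrier_mat ?n ?n" "?P' \<in> carrier_mat ?n ?n"
    by (rule perm_mat_carrier)+
  have "?P * g * ?P' * kron h (1\<^sub>m (2 ^ r)) = kron h (1\<^sub>m (2 ^ r)) * (?P * g * ?P')" if h: "h \<in> F" for h
  proof -
    let ?h = "kron h (1\<^sub>m (2 ^ r))"
    have h': "h \<in> carrier_mat k k"
      using h F GLm_carrier by blast
    then have hc: "?h \<in> carrier_mat ?n ?n"
      by (simp add: kron_carrier)
    have com: "?P * ?h = ?h * ?P" "?P' * ?h = ?h * ?P'" "g * ?h = ?h * g"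
      using perm_mat_kron_commute[OF A h'] perm_mat_kron_commute[OF A(2,1,4,3) h'] g h
      by (auto simp: shifted_centralizer_def)
    have "?P * g * ?P' * ?h = ?P * g * (?P' * ?h)"
      using P gc hc by (simp add: assoc_mult_mat[of _ ?n ?n _ ?n _ ?n])
    also have "\<dots> = ?P * (g * ?h) * ?P'"
      using P gc hc by (simp add: com(2) assoc_mult_mat[of _ ?n ?n _ ?n _ ?n])
    also have "\<dots> = (?P * ?h) * g * ?P'"
      using P gc hc by (simp add: com(3) assoc_mult_mat[of _ ?n ?n _ ?n _ ?n])
    also have "\<dots> = ?h * (?P * g * ?P')"
      using P gc hc by (simp add: com(1) assoc_mult_mat[of _ ?n ?n _ ?n _ ?n])
    finally show ?thesis .
  qed
  moreover have "?P * g * ?P' \<in> GLm ?n"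
    by (intro GLm_mult gG perm_mat_GLm[OF A(1-3)] perm_mat_GLm[OF A(2,1,4)])
  ultimately show ?thesis
    using shift_support_perm_conj[OF A gc supp w] by (auto simp: shifted_centralizer_def)
qed

text \<open>Transfers the hypotheses on the group \<open>pgen k F\<close> to its generators: in the
  trivial case these are scalar, otherwise connectedness fixes the sign.\<close>

lemma pcentralizer_commute:
  fixes F :: "'a::field mat set"
  assumes char: "(2::'a) \<noteq> 0" and k: "k > 0" and F: "F \<subseteq> GLm k"
    and H: "pgen k F = scal {1\<^sub>m k} \<or>
            ((\<forall>h\<in>pgen k F. h * h \<in> scal {1\<^sub>m k})
             \<and> connectedin (zariski_GL k) (pcentralizer k (pgen k F)))"
    and x: "x \<in> pcentralizer k F" and h: "h \<in> F"
  shows "x * h = h * x"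
  using H
proof
  assume "pgen k F = scal {1\<^sub>m k}"
  then obtain c where "h = c \<cdot>\<^sub>m 1\<^sub>m k"
    using pgen.gen[OF h, of k] by (auto simp: scal_def)
  moreover have "x \<in> carrier_mat k k"
    using x GLm_carrier by (auto simp: pcentralizer_def)
  ultimately show ?thesis
    by (simp add: smult_mult_mat[of _ k])
next
  assume H: "(\<forall>h\<in>pgen k F. h * h \<in> scal {1\<^sub>m k}) \<and> connectedin (zariski_GL k) (pcentralizer k (pgen k F))"
  have "pgen k F \<subseteq> GLm k"
    using pgen_GLm[OF F] by blast
  moreover have "x \<in> pcentralizer k (pgen k F)"
    using x pcentralizer_pgen[OF F k] by simp
  ultimately show ?thesis
    using connected_pcentralizer_commute[OF char k] H pgen.gen[OF h] by blast
qed

text \<open>The equation makes \<open>B'\<close> after \<open>A\<close> a translation by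
  \<open>w\<close>. A linear map fixes the zero vector, so the translation is trivial.\<close>

lemma perm_mat_pcentralizer_injective:
  fixes c :: "'a::field mat"
  assumes A: "A \<in> carrier_mat r r"
    and B: "B \<in> carrier_mat r r" "B' \<in> carrier_mat r r" "B * B' = 1\<^sub>m r" "B' * B = 1\<^sub>m r"
    and k: "k > 0" and w: "w \<in> carrier_vec r" and c: "c \<in> shifted_centralizer r k F w"
    and eq: "perm_mat r k A = perm_mat r k B * c"
  shows "A = B"
proof (rule mat_eq_by_vec[OF A B(1)])
  let ?n = "2 ^ r * k"
  have cc: "c \<in> carrier_mat ?n ?n" and supp: "shift_support r k c w"
    using c GLm_carrier by (auto simp: shifted_centralizer_def)
  have main: "v = B' *\<^sub>v (A *\<^sub>v v) + w" if v: "v \<in> carrier_vec r" for v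
  proof -
    \<comment> \<open>A column with digit vector \<open>v\<close>; place 0 in the other factor
      exists because \<open>k > 0\<close>.\<close>
    define j where "j = index r 0 v"
    have j: "j < ?n" "linear_perm r A j < ?n" "linear_perm r B' (linear_perm r A j) < ?n"
      using k by (auto simp: j_def index_less intro!: linear_perm_less)
    have bj: "bits r j = v"
      using v by (simp add: j_def)
    have "perm_mat r k A $$ (linear_perm r A j, j) = (1::'a)"
      using j by (simp add: perm_mat_def)
    then have "c $$ (linear_perm r B' (linear_perm r A j), j) = 1"
      unfolding eq perm_mat_mult_entry[OF cc j(2,1) B] .
    then have "bits r j = bits r (linear_perm r B' (linear_perm r A j)) + w"
      using supp j by (auto simp: shift_support_def)
    then show ?thesis
      using A B by (simp add: bits_linear_perm bj)
  qed
  have zero: "X *\<^sub>v 0\<^sub>v r = 0\<^sub>v r" if "X \<in> carrier_mat r r" for X :: "bit mat"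
    using that by (intro eq_vecI) auto
  have "0\<^sub>v r = B' *\<^sub>v (A *\<^sub>v 0\<^sub>v r) + w"
    by (rule main) simp
  then have w0: "w = 0\<^sub>v r"
    using A B(2) w by (simp add: zero)
  fix v :: "bit vec" assume v: "v \<in> carrier_vec r"
  have Av: "A *\<^sub>v v \<in> carrier_vec r"
    using A v by simp
  have "v = B' *\<^sub>v (A *\<^sub>v v)"
    using main[OF v] w0 B(2) Av by simp
  then have "B *\<^sub>v v = B *\<^sub>v (B' *\<^sub>v (A *\<^sub>v v))"
    by simp
  also have "\<dots> = A *\<^sub>v v"
    using B Av by (simp add: assoc_mult_mat_vec[symmetric, where v = "A *\<^sub>v v"])
  finally show "A *\<^sub>v v = B *\<^sub>v v" by simp
qed

text \<open>The permutation matrix of the translation by \<open>w\<close>.\<close>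
lemma shifted_centralizer_nonempty:
  fixes F :: "'a::field mat set"
  assumes F: "F \<subseteq> GLm k" and w: "w \<in> carrier_vec r"
  shows "shifted_centralizer r k F w \<noteq> {}"
proof -
  let ?n = "2 ^ r * k"
  define \<tau> where "\<tau> i = index r (i div 2 ^ r) (bits r i + w)" for i
  \<comment> \<open>This is \<open>1\<^sub>m k\<close> tensored with the product of those B_{s'} for
    which \<open>w $ s' = 1\<close>, since each B_{s'} flips digit s'.\<close>
  define g :: "'a mat" where "g = mat ?n ?n (\<lambda>(i, j). if j = \<tau> i then 1 else 0)"
  have bw: "bits r i + w \<in> carrier_vec r" for i
    using bits_carrier w by simp
  have \<tau>: "\<tau> i < ?n" if "i < ?n" for i
    using that by (simp add: \<tau>_def index_less div_less_block)
  have b\<tau>: "bits r (\<tau> i) = bits r i + w" "\<tau> i div 2 ^ r = i div 2 ^ r" for i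
    using bw by (simp_all add: \<tau>_def)
  have \<tau>\<tau>: "\<tau> (\<tau> i) = i" for i
  proof -
    have "bits r (\<tau> i) + w = bits r i"
      using bits_carrier[of r i] w by (simp add: b\<tau> assoc_add_vec[of _ r] bit_vec_add_self)
    then show ?thesis
      by (simp add: \<tau>_def[of "\<tau> i"] b\<tau>(2))
  qed
  have gc: "g \<in> carrier_mat ?n ?n"
    by (simp add: g_def)
  have left: "(g * x) $$ (i, j) = x $$ (\<tau> i, j)"
    if "x \<in> carrier_mat ?n ?n" "i < ?n" "j < ?n" for x i j
    using that \<tau> by (subst mat_mult_entry[OF gc]) (simp_all add: g_def mult_delta_left)
  have right: "(x * g) $$ (i, j) = x $$ (i, \<tau> j)"
    if "x \<in> carrier_mat ?n ?n" "i < ?n" "j < ?n" for x i j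
  proof -
    have "j = \<tau> l \<longleftrightarrow> l = \<tau> j" for l
      using \<tau>\<tau> by metis
    then show ?thesis
      using that \<tau> by (subst mat_mult_entry[OF _ gc]) (simp_all add: g_def mult_delta_right)
  qed
  have "g * g = 1\<^sub>m ?n"
  proof (rule eq_matI)
    fix i j assume "i < dim_row (1\<^sub>m ?n)" "j < dim_col (1\<^sub>m ?n)"
    then have ij: "i < ?n" "j < ?n" by auto
    show "(g * g) $$ (i, j) = 1\<^sub>m ?n $$ (i, j)"
      using ij \<tau>[OF ij(1)] by (subst left[OF gc ij]) (auto simp: g_def \<tau>\<tau>)
  qed (use gc in auto)
  then have "g \<in> GLm ?n"
    using GLmI(1)[OF gc gc] by blast
  moreover have "shift_support r k g w"
    by (auto simp: shift_support_def g_def b\<tau>)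
  moreover have "g * kron h (1\<^sub>m (2 ^ r)) = kron h (1\<^sub>m (2 ^ r)) * g" if "h \<in> F" for h
  proof -
    let ?h = "kron h (1\<^sub>m (2 ^ r))"
    have h: "h \<in> carrier_mat k k"
      using that F GLm_carrier by blast
    then have hc: "?h \<in> carrier_mat ?n ?n"
      by (simp add: kron_carrier)
    show ?thesis
    proof (rule eq_matI)
      fix i j assume "i < dim_row (?h * g)" "j < dim_col (?h * g)"
      then have ij: "i < ?n" "j < ?n" using hc gc by auto
      have "bits r (\<tau> i) = bits r j \<longleftrightarrow> bits r i = bits r (\<tau> j)"
        using \<tau>\<tau> b\<tau>(1) by metis
      then have "?h $$ (\<tau> i, j) = ?h $$ (i, \<tau> j)"
        using ij \<tau> h by (simp add: kron_one_right[of _ r k] b\<tau>(2))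
      then show "(g * ?h) $$ (i, j) = (?h * g) $$ (i, j)"
        by (simp only: left[OF hc ij] right[OF hc ij])
    qed (use hc gc in auto)
  qed
  ultimately show ?thesis
    by (auto simp: shifted_centralizer_def)
qed

lemma shifted_centralizer_conjugate:
  fixes F :: "'a::field mat set"
  assumes F: "F \<subseteq> GLm k" and k: "k > 0"
    and C: "pcentralizer (2 ^ r * k) (Dpre r k F) = (\<Union>w\<in>carrier_vec r. shifted_centralizer r k F w)"
    and v: "v \<in> carrier_vec r" "v \<noteq> 0\<^sub>v r" and x: "x \<in> shifted_centralizer r k F v"
    and w: "w \<in> carrier_vec r" "w \<noteq> 0\<^sub>v r" and y: "y \<in> shifted_centralizer r k F w"
  shows "\<exists>g\<in>pnormalizer (2 ^ r * k) (Dpre r k F).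
    \<exists>c\<in>shifted_centralizer r k F (0\<^sub>v r). g * x = y * c * g"
proof -
  let ?n = "2 ^ r * k"
  obtain A where A: "A \<in> carrier_mat r r" "A * A = 1\<^sub>m r" "A *\<^sub>v v = w"
    using transvection_exists v w by blast
  let ?P = "perm_mat r k A :: 'a mat"
  have Pc: "?P \<in> carrier_mat ?n ?n" and PP: "?P * ?P = 1\<^sub>m ?n"
    using A by (simp_all add: perm_mat_carrier perm_mat_mult perm_mat_one)
  have yG: "y \<in> GLm ?n" and yC: "y \<in> pcentralizer ?n (Dpre r k F)"
    using y w C by (auto simp: shifted_centralizer_def)
  obtain y' where y': "y' \<in> GLm ?n" "y * y' = 1\<^sub>m ?n" "y' * y = 1\<^sub>m ?n"
    using yG by (rule GLm_inverse)
  have D: "Dpre r k F \<subseteq> GLm ?n"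
    using pgen_GLm[OF generators_GLm[OF F]] by (auto simp: Dpre_generators)
  then have Dc: "Dpre r k F \<subseteq> carrier_mat ?n ?n"
    using GLm_carrier by blast
  have y'C: "y' \<in> pcentralizer ?n (Dpre r k F)"
    using pcentralizer_inverse[OF D _ yC y'] k by simp
  \<comment> \<open>The conjugate of \<open>x\<close> by the involution \<open>?P\<close>. It has
    the same shift \<open>w\<close> as \<open>y\<close>, so the two can differ only by an element of
    shift 0.\<close>
  define z where "z = ?P * x * ?P"
  have "x \<in> carrier_mat ?n ?n"
    using x GLm_carrier by (auto simp: shifted_centralizer_def)
  then have zP: "z * ?P = ?P * x"
    using Pc PP unfolding z_def by (simp add: assoc_mult_mat[of _ ?n ?n _ ?n _ ?n])
  have z: "z \<in> shifted_centralizer r k F w"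
    using shifted_centralizer_perm_conj[OF A(1,1,2,2) F v(1) x] A(3) by (simp add: z_def)
  then have zC: "z \<in> pcentralizer ?n (Dpre r k F)"
    using w C by auto
  have zsupp: "shift_support r k z w" and zG: "z \<in> GLm ?n"
    using z by (auto simp: shifted_centralizer_def)
  have c: "y \<in> carrier_mat ?n ?n" "y' \<in> carrier_mat ?n ?n" "z \<in> carrier_mat ?n ?n"
    using yG y'(1) zG GLm_carrier by blast+
  have "y' * z \<in> pcentralizer ?n (Dpre r k F)"
    using pcentralizer_mult[OF Dc y'C zC] .
  then obtain u where u: "u \<in> carrier_vec r" "y' * z \<in> shifted_centralizer r k F u"
    using C by auto
  \<comment> \<open>The shift of \<open>y' * z\<close> is read off from this identity:
    \<open>w + u = w\<close>. The shift of \<open>y'\<close> itself never has to be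
    determined.\<close>
  have yy'z: "y * (y' * z) = z"
    using c y'(2) by (simp add: assoc_mult_mat[of _ ?n ?n _ ?n _ ?n, symmetric])
  have "shift_support r k y w" "shift_support r k (y' * z) u"
    using y u by (simp_all add: shifted_centralizer_def)
  then have "shift_support r k (y * (y' * z)) (w + u)"
    by (rule shift_support_mult[OF c(1) mult_carrier_mat[OF c(2,3)] _ _ w(1) u(1)])
  then have "shift_support r k z (w + u)"
    by (simp only: yy'z)
  then have "w + u = w"
    by (rule shift_support_unique[OF zG k _ zsupp add_carrier_vec[OF w(1) u(1)] w(1)])
  then have "w + u = w + 0\<^sub>v r"
    using w by simp
  then have "u = 0\<^sub>v r"
    using bit_vec_add_cancel[OF w(1) u(1)] by simp
  then have "y' * z \<in> shifted_centralizer r k F (0\<^sub>v r)"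
    using u by simp
  moreover have "?P * x = y * (y' * z) * ?P"
    by (simp only: yy'z zP)
  moreover have "?P \<in> pnormalizer ?n (Dpre r k F)"
    using perm_mat_pnormalizer[OF A(1,1,2,2) F] .
  ultimately show ?thesis by blast
qed

theorem theorem4p11:
  fixes F :: "'a::field mat set" and n s t r k :: nat
  assumes alg_closed: "\<forall>p :: 'a poly. degree p \<ge> 1 \<longrightarrow> (\<exists>x. poly p x = 0)"
    and char: "(2::'a) \<noteq> 0"
    and n_def: "n = 2^s * t" and t_odd: "odd t" and s_pos: "s \<ge> 1" and t_pos: "t \<ge> 1"
    and r_bounds: "1 \<le> r" "r \<le> s" and n_k: "n = 2^r * k"
    and F_fin: "finite F" and F_GL: "F \<subseteq> GLm k"
    and H: "pgen k F = scal {1\<^sub>m k} \<or>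
            ((\<forall>h\<in>pgen k F. h * h \<in> scal {1\<^sub>m k})
             \<and> (\<forall>a\<in>pgen k F. \<forall>b\<in>pgen k F. \<exists>c. a * b = c \<cdot>\<^sub>m (b * a))
             \<and> (\<exists>T. maximal_torus k T \<and> (\<forall>h\<in>pgen k F. \<exists>c. c \<noteq> 0 \<and> c \<cdot>\<^sub>m h \<in> T))
             \<and> connectedin (zariski_GL k) (pcentralizer k (pgen k F)))"
  shows "(\<exists>\<phi> :: bit mat \<Rightarrow> 'a mat.
            (\<forall>A\<in>GL2 r. \<phi> A \<in> pnormalizer n (Dpre r k F))
          \<and> (\<forall>A\<in>GL2 r. \<forall>B\<in>GL2 r. \<exists>c\<in>pcentralizer n (Dpre r k F). \<phi> (A * B) = \<phi> A * \<phi> B * c)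
          \<and> (\<forall>A\<in>GL2 r. \<forall>B\<in>GL2 r.
                (\<exists>c\<in>pcentralizer n (Dpre r k F). \<phi> A = \<phi> B * c) \<longrightarrow> A = B))
       \<and> (\<exists>x\<in>pcentralizer n (Dpre r k F).
             x \<notin> identity_component n (pcentralizer n (Dpre r k F)))
       \<and> (\<forall>x\<in>pcentralizer n (Dpre r k F) - identity_component n (pcentralizer n (Dpre r k F)).
          \<forall>y\<in>pcentralizer n (Dpre r k F) - identity_component n (pcentralizer n (Dpre r k F)).
            \<exists>g\<in>pnormalizer n (Dpre r k F).
              \<exists>c\<in>identity_component n (pcentralizer n (Dpre r k F)). g * x = y * c * g)"
proof -
  have k: "k > 0"
    using n_k n_def t_pos by (cases k) auto
  have comm: "x * h = h * x" if "x \<in> pcentralizer k F" "h \<in> F" for x h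
    using pcentralizer_commute[OF char k F_GL _ that] H by blast
  have C: "pcentralizer n (Dpre r k F) = (\<Union>w\<in>carrier_vec r. shifted_centralizer r k F w)"
    unfolding n_k using F_GL k char comm by (rule pcentralizer_Dpre)
  have C0: "identity_component n (pcentralizer n (Dpre r k F)) = shifted_centralizer r k F (0\<^sub>v r)"
    using identity_component_shifted[OF infinite_algebraically_closed[OF alg_closed] F_GL k C] by (simp only: n_k)
  have GL2: "\<exists>A'. A \<in> carrier_mat r r \<and> A' \<in> carrier_mat r r \<and> A * A' = 1\<^sub>m r \<and> A' * A = 1\<^sub>m r"
    if "A \<in> GL2 r" for A
    using that nonzero_det_inverse[of A r] by (auto simp: GL2_def)
  let ?\<phi> = "perm_mat r k :: bit mat \<Rightarrow> 'a mat"
  have normalizes: "\<forall>A\<in>GL2 r. ?\<phi> A \<in> pnormalizer n (Dpre r k F)"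
    unfolding n_k using GL2 perm_mat_pnormalizer[OF _ _ _ _ F_GL] by blast
  have hom: "\<forall>A\<in>GL2 r. \<forall>B\<in>GL2 r. \<exists>c\<in>pcentralizer n (Dpre r k F). ?\<phi> (A * B) = ?\<phi> A * ?\<phi> B * c"
  proof (intro ballI)
    fix A B assume "A \<in> GL2 r" "B \<in> GL2 r"
    then have AB: "A \<in> carrier_mat r r" "B \<in> carrier_mat r r"
      by (auto simp: GL2_def)
    have "1\<^sub>m n \<in> pcentralizer n (Dpre r k F)"
      unfolding C using one_shifted_centralizer[OF F_GL, of r] zero_carrier_vec n_k by blast
    \<comment> \<open>The map is a homomorphism already in \<open>GLm\<close>, so the correcting
      factor is the identity matrix.\<close>
    moreover have "?\<phi> (A * B) = ?\<phi> A * ?\<phi> B * 1\<^sub>m n"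
      using perm_mat_mult[OF AB, of k, where ?'a = 'a] perm_mat_carrier[of r k "A * B", where ?'a = 'a] n_k by simp
    ultimately show "\<exists>c\<in>pcentralizer n (Dpre r k F). ?\<phi> (A * B) = ?\<phi> A * ?\<phi> B * c"
      by blast
  qed
  have inj: "\<forall>A\<in>GL2 r. \<forall>B\<in>GL2 r. (\<exists>c\<in>pcentralizer n (Dpre r k F). ?\<phi> A = ?\<phi> B * c) \<longrightarrow> A = B"
  proof (intro ballI impI)
    fix A B assume AB: "A \<in> GL2 r" "B \<in> GL2 r"
      and ex: "\<exists>c\<in>pcentralizer n (Dpre r k F). ?\<phi> A = ?\<phi> B * c"
    have A: "A \<in> carrier_mat r r"
      using AB by (simp add: GL2_def)
    obtain B' where B: "B \<in> carrier_mat r r" "B' \<in> carrier_mat r r" "B * B' = 1\<^sub>m r" "B' * B = 1\<^sub>m r"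
      using GL2[OF AB(2)] by blast
    obtain c w where "w \<in> carrier_vec r" "c \<in> shifted_centralizer r k F w" "?\<phi> A = ?\<phi> B * c"
      using ex unfolding C by blast
    then show "A = B"
      by (rule perm_mat_pcentralizer_injective[OF A B k])
  qed
  have nonzero: "\<exists>w\<in>carrier_vec r. w \<noteq> 0\<^sub>v r \<and> x \<in> shifted_centralizer r k F w"
    if "x \<in> pcentralizer n (Dpre r k F) - identity_component n (pcentralizer n (Dpre r k F))" for x
    using that unfolding C0 unfolding C by (metis DiffD1 DiffD2 UN_E)
  have disconnected: "\<exists>x\<in>pcentralizer n (Dpre r k F). x \<notin> identity_component n (pcentralizer n (Dpre r k F))"
  proof -
    \<comment> \<open>The second orbit must be nonempty: as \<open>r\<close> is at least 1, this is
      a nonzero shift, and every shift is realized by a translation matrix.\<close>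
    let ?w = "unit_vec r 0 :: bit vec"
    have w: "?w \<in> carrier_vec r" "?w \<noteq> 0\<^sub>v r"
      using r_bounds by auto
    obtain x where x: "x \<in> shifted_centralizer r k F ?w"
      using shifted_centralizer_nonempty[OF F_GL w(1)] by blast
    moreover have "x \<notin> shifted_centralizer r k F (0\<^sub>v r)"
      using shift_support_unique[OF _ k _ _ w(1) zero_carrier_vec, of x] x w(2)
      by (auto simp: shifted_centralizer_def)
    ultimately show ?thesis
      unfolding C0 unfolding C using w(1) by blast
  qed
  have orbit: "\<exists>g\<in>pnormalizer n (Dpre r k F).
      \<exists>c\<in>identity_component n (pcentralizer n (Dpre r k F)). g * x = y * c * g"
    if x: "x \<in> pcentralizer n (Dpre r k F) - identity_component n (pcentralizer n (Dpre r k F))"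
      and y: "y \<in> pcentralizer n (Dpre r k F) - identity_component n (pcentralizer n (Dpre r k F))" for x y
  proof -
    obtain v where v: "v \<in> carrier_vec r" "v \<noteq> 0\<^sub>v r" "x \<in> shifted_centralizer r k F v"
      using nonzero[OF x] by blast
    obtain w where w: "w \<in> carrier_vec r" "w \<noteq> 0\<^sub>v r" "y \<in> shifted_centralizer r k F w"
      using nonzero[OF y] by blast
    show ?thesis
      unfolding C0 unfolding n_k
      by (rule shifted_centralizer_conjugate[OF F_GL k C[unfolded n_k] v w])
  qed
  show ?thesis
    by (intro conjI exI[of _ ?\<phi>], fact normalizes, fact hom, fact inj, fact disconnected,
        intro ballI, rule orbit)
qed

end
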